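(* Let $B=\lambda\mathbf{I}$ with $\lambda>0$ and let $f:\mathbb{R}^d\to\mathbb{R}$ be continuously differentiable with Lipschitz continuous gradient with constant $L_1>0$, i.e. $\|\nabla f(z_1)-\nabla f(z_2)\|_*\le L_1\|z_1-z_2\|$ for all $z_1,z_2\in\mathbb{R}^d$. Let $\mathcal{Z}=\mathcal{X}\times\mathcal{Y}\subset\mathbb{R}^n\times\mathbb{R}^m$ be nonempty, compact and convex with diameter $D_z=\sup\{\|z_1-z_2\|:z_1,z_2\in\mathcal{Z}\}$. Let $\mu>0$ and let $\sigma\ge 0$ satisfy $E_u[\|G_\mu(z;u)-F_\mu(z)\|_*^2]\le\sigma^2$ for all $z\in\mathbb{R}^d$. Suppose that for some $\rho\in(0,\frac{1}{24L_1})$ there is $z^*\in\mathcal{Z}$ satisfying the proximal weak Minty variational inequality: for all $z,\bar z\in\mathcal{Z}$ and all $a'>0$, $$\langle P_{\mathcal{Z}}(z,a',F(\bar z)),\bar z-z^*\rangle+\frac{\rho}{2}\|P_{\mathcal{Z}}(z,a',F(\bar z))\|_*^2\ge 0.$$ Let $\{z_k\},\{\hat z_k\}$ be generated by the (projected) variance-reduced zeroth-order extragradient algorithm with constant sample size $t_k=t\in\mathbb{N}$, $t\ge1$, and $h_{1,k}=h_{2,k}=h$, where $h\in\left(\sqrt{\frac{6\rho}{L_1\lambda^2}},\frac{1}{2L_1\lambda}\right]$. Let $p_k=P_{\mathcal{Z}}(z_k,h,F(z_k))$, $r_0=|z_0-z^*|$, $$a=\frac{4\rho\lambda L_1^2(d+3)^3}{\lambda^2L_1h^2-6\rho},\quad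 b=\frac{4\lambda L_1D_z(d+3)^{3/2}}{\lambda^2L_1h^2-6\rho},\quad c=\frac{(36\rho+\frac{4}{L_1}+4)\lambda\sigma^2}{\lambda^2L_1h^2-6\rho},\quad e=\frac{2D_z\lambda\sigma}{\lambda^2L_1h^2-6\rho},$$ and let $\epsilon>0$. If $$t\ge32\left\lceil\max\{c\,\epsilon^{-2},e^2\epsilon^{-4}\}\right\rceil,\quad\mu\le\min\left\{\frac{-b+\sqrt{b^2+a\epsilon^2}}{2a},\frac{\epsilon}{\sqrt2\,\lambda L_1(d+3)^{3/2}}\right\},\quad N\ge\left\lceil\left(\frac{32\lambda^2L_1r_0^2}{\lambda^2L_1h^2-6\rho}\right)\epsilon^{-2}-1\right\rceil,$$ then $$\frac{1}{N+1}\sum_{k=0}^{N}E_{\mathcal{U}_k}[|p_k|^2]\le\epsilon^2.$$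
   Context: $n,m\in\mathbb{N}$, $d=n+m$, points $z=(x,y)\in\mathbb{R}^n\times\mathbb{R}^m=\mathbb{R}^d$. $B=\lambda\mathbf{I}$ with $\lambda>0$. $\langle\cdot,\cdot\rangle$ is the Euclidean inner product, $|z|=\langle z,z\rangle^{1/2}$, $\|z\|=\langle z,Bz\rangle^{1/2}=\sqrt{\lambda}|z|$, $\|z\|_*=\langle z,B^{-1}z\rangle^{1/2}=|z|/\sqrt{\lambda}$. $F(z)=(\nabla_x f(z),-\nabla_y f(z))$. For $\mu>0$ the Gaussian smoothing of $f$ is $f_\mu(z)=E_u[f(z+\mu u)]$ with $u\sim\mathcal{N}(0,B^{-1})$, and $F_\mu(z)=(\nabla_x f_\mu(z),-\nabla_y f_\mu(z))$. For $u=(u_1,u_2)\in\mathbb{R}^n\times\mathbb{R}^m$ the random oracle is $G_\mu(z;u)=\frac{f(z+\mu u)-f(z)}{\mu}\,(\lambda u_1,-\lambda u_2)$. $\mathrm{Proj}_{\mathcal{Z}}(w)=\arg\min_{z\in\mathcal{Z}}\|z-w\|^2$, and $P_{\mathcal{Z}}(z,h,g)=\frac1h\left[z-\mathrm{Proj}_{\mathcal{Z}}(z-hg)\right]$ for $h>0$, $g\in\mathbb{R}^d$. Variance-reduced ZO-EG (projected): given $z_0\in\mathcal{Z}$, for $k=0,1,\dots,N$: sample $\hat u_k^1,\dots,\hat u_k^{t_k}\sim\mathcal{N}(0,B^{-1})$ and set $\hat z_k=\mathrm{Proj}_{\mathcal{Z}}\big(z_k-h_{1,k}\frac{1}{t_k}\sum_{i=1}^{t_k}G_\mu(z_k;\hat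 u_k^i)\big)$; sample $u_k^1,\dots,u_k^{t_k}\sim\mathcal{N}(0,B^{-1})$ and set $z_{k+1}=\mathrm{Proj}_{\mathcal{Z}}\big(z_k-h_{2,k}\frac{1}{t_k}\sum_{i=1}^{t_k}G_\mu(\hat z_k;u_k^i)\big)$. All sampled vectors are independent. $\mathcal{U}_k=[(u_0,\hat u_0),\dots,(u_k,\hat u_k)]$, where $u_j,\hat u_j$ denote the batches sampled at iteration $j$, and $E_{\mathcal{U}_k}$ is expectation over $\mathcal{U}_k$. *)

theory Defs
  imports "HOL-Probability.Probability"
begin

text \<open>
  The norms \<open>\<parallel>z\<parallel> = \<langle>z, B z\<rangle>\<^sup>1\<^sup>/\<^sup>2\<close> and \<open>\<parallel>z\<parallel>\<^sub>* = \<langle>z, B\<^sup>-\<^sup>1 z\<rangle>\<^sup>1\<^sup>/\<^sup>2\<close> for \<open>B = \<lambda> I\<close>.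
  The Euclidean norm is the library's \<^const>\<open>norm\<close>, also on pairs \<open>z = (x, y)\<close>.
\<close>

definition bnorm :: "real \<Rightarrow> 'a::real_inner \<Rightarrow> real" where
  "bnorm lam z = sqrt (z \<bullet> (lam *\<^sub>R z))"

definition dnorm :: "real \<Rightarrow> 'a::real_inner \<Rightarrow> real" where
  "dnorm lam z = sqrt (z \<bullet> (inverse lam *\<^sub>R z))"

definition bdiam :: "real \<Rightarrow> 'a::real_inner set \<Rightarrow> real" where
  "bdiam lam Z = Sup {bnorm lam (z1 - z2) | z1 z2. z1 \<in> Z \<and> z2 \<in> Z}"

text \<open>The gradient is unspecified at points where \<open>f\<close> is not differentiable.\<close>

definition grad :: "('a::real_inner \<Rightarrow> real) \<Rightarrow> 'a \<Rightarrow> 'a" where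
  "grad f z = (THE g. GDERIV f z :> g)"

definition saddle_op ::
  "('a::euclidean_space \<times> 'b::euclidean_space \<Rightarrow> real) \<Rightarrow> 'a \<times> 'b \<Rightarrow> 'a \<times> 'b" where
  "saddle_op f z = (grad (\<lambda>x. f (x, snd z)) (fst z), - grad (\<lambda>y. f (fst z, y)) (snd z))"

text \<open>Density and law of \<open>N(0, B\<^sup>-\<^sup>1)\<close>, where \<open>det B = \<lambda>\<^sup>d\<close>.\<close>

definition gauss_density :: "real \<Rightarrow> 'a::euclidean_space \<Rightarrow> real" where
  "gauss_density lam u = sqrt (lam ^ DIM('a) / (2 * pi) ^ DIM('a)) * exp (- (bnorm lam u)\<^sup>2 / 2)"

definition gauss :: "real \<Rightarrow> 'a::euclidean_space measure" where
  "gauss lam = density lborel (\<lambda>u. ennreal (gauss_density lam u))"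

definition smoothing :: "real \<Rightarrow> real \<Rightarrow> ('a::euclidean_space \<Rightarrow> real) \<Rightarrow> 'a \<Rightarrow> real" where
  "smoothing lam mu f z = (\<integral>u. f (z + mu *\<^sub>R u) \<partial>gauss lam)"

definition oracle_G :: "real \<Rightarrow> real \<Rightarrow> ('a::euclidean_space \<times> 'b::euclidean_space \<Rightarrow> real)
    \<Rightarrow> 'a \<times> 'b \<Rightarrow> 'a \<times> 'b \<Rightarrow> 'a \<times> 'b" where
  "oracle_G lam mu f z u =
     ((f (z + mu *\<^sub>R u) - f z) / mu) *\<^sub>R (lam *\<^sub>R fst u, - (lam *\<^sub>R snd u))"

definition Proj :: "real \<Rightarrow> 'a::real_inner set \<Rightarrow> 'a \<Rightarrow> 'a" where
  "Proj lam Z w = arg_min (\<lambda>z. (bnorm lam (z - w))\<^sup>2) (\<lambda>z. z \<in> Z)"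

definition prox_map :: "real \<Rightarrow> 'a::real_inner set \<Rightarrow> 'a \<Rightarrow> real \<Rightarrow> 'a \<Rightarrow> 'a" where
  "prox_map lam Z z h g = (1 / h) *\<^sub>R (z - Proj lam Z (z - h *\<^sub>R g))"

definition batch_G :: "real \<Rightarrow> real \<Rightarrow> ('a::euclidean_space \<times> 'b::euclidean_space \<Rightarrow> real)
    \<Rightarrow> nat \<Rightarrow> (nat \<Rightarrow> 'a \<times> 'b) \<Rightarrow> 'a \<times> 'b \<Rightarrow> 'a \<times> 'b" where
  "batch_G lam mu f t u z = (1 / real t) *\<^sub>R (\<Sum>i=1..t. oracle_G lam mu f z (u i))"

text \<open>
  The sequences \<open>z\<close> and \<open>zh\<close> are those generated by the projected variance-reduced zeroth-order
  extragradient algorithm in iterations \<open>0..N\<close> from one realisation \<open>uh k i\<close>, \<open>u k i\<close>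
  (\<open>1 \<le> i \<le> t k\<close>) of the samples.
\<close>

definition vr_zo_eg :: "real \<Rightarrow> real \<Rightarrow> ('a::euclidean_space \<times> 'b::euclidean_space \<Rightarrow> real)
    \<Rightarrow> ('a \<times> 'b) set \<Rightarrow> (nat \<Rightarrow> real) \<Rightarrow> (nat \<Rightarrow> real) \<Rightarrow> (nat \<Rightarrow> nat) \<Rightarrow> nat \<Rightarrow> 'a \<times> 'b
    \<Rightarrow> (nat \<Rightarrow> nat \<Rightarrow> 'a \<times> 'b) \<Rightarrow> (nat \<Rightarrow> nat \<Rightarrow> 'a \<times> 'b)
    \<Rightarrow> (nat \<Rightarrow> 'a \<times> 'b) \<Rightarrow> (nat \<Rightarrow> 'a \<times> 'b) \<Rightarrow> bool" where
  "vr_zo_eg lam mu f Z h1 h2 t N z0 uh u z zh \<longleftrightarrow>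
     z 0 = z0 \<and>
     (\<forall>k\<le>N. zh k = Proj lam Z (z k - h1 k *\<^sub>R batch_G lam mu f (t k) (uh k) (z k)) \<and>
            z (Suc k) = Proj lam Z (z k - h2 k *\<^sub>R batch_G lam mu f (t k) (u k) (zh k)))"

text \<open>
  The samples \<open>uh k i\<close> and \<open>u k i\<close> (\<open>k \<le> N\<close>, \<open>1 \<le> i \<le> t k\<close>), random vectors on \<open>M\<close>, are all
  \<open>N(0, B\<^sup>-\<^sup>1)\<close>-distributed; the disjoint sum makes the two families one jointly independent family.
\<close>

definition gauss_samples :: "'w measure \<Rightarrow> real \<Rightarrow> (nat \<Rightarrow> nat) \<Rightarrow> nat
    \<Rightarrow> (nat \<Rightarrow> nat \<Rightarrow> 'w \<Rightarrow> 'a::euclidean_space) \<Rightarrow> (nat \<Rightarrow> nat \<Rightarrow> 'w \<Rightarrow> 'a) \<Rightarrow> bool" where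
  "gauss_samples M lam t N uh u \<longleftrightarrow>
     (\<forall>k\<le>N. \<forall>i\<in>{1..t k}.
        distributed M lborel (uh k i) (\<lambda>v. ennreal (gauss_density lam v)) \<and>
        distributed M lborel (u k i) (\<lambda>v. ennreal (gauss_density lam v))) \<and>
     prob_space.indep_vars M (\<lambda>_. borel) (case_sum (\<lambda>(k, i). uh k i) (\<lambda>(k, i). u k i))
       ((SIGMA k:{..N}. {1..t k}) <+> (SIGMA k:{..N}. {1..t k}))"

end

theory Submission
  imports Defs
begin

text \<open>
  Let \<open>L = \<lambda> L\<^sub>1\<close>, \<open>F = saddle_op f\<close>, and let \<open>m(z)\<close> be the mean of the oracle at \<open>z\<close>. Since
  \<open>\<lambda> E[\<langle>\<nabla>f(z), u\<rangle> u] = \<nabla>f(z)\<close> and the first-order error of \<open>f\<close> is at most \<open>L \<mu>\<^sup>2 |u|\<^sup>2\<close>, the bias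
  \<open>|m - F|\<close> is at most \<open>\<beta> = \<lambda> \<mu> L E|u|\<^sup>3\<close>. A batch is independent of the point at which it is
  evaluated, so its mean squared distance to \<open>m\<close> is at most \<open>S\<^sup>2 = \<lambda>\<sigma>\<^sup>2/t\<close>.

  For one iteration compare with \<open>w = Proj(z\<^sub>k - h F(\<^bold>z\<^sub>k))\<close>, where \<open>\<^bold>z\<^sub>k\<close> is the extrapolated point.
  The Minty inequality at \<open>\<^bold>z\<^sub>k\<close> gives
  \<open>|w - z*|\<^sup>2 \<le> |z\<^sub>k - z*|\<^sup>2 + \<rho>/(\<lambda>h) |z\<^sub>k - w|\<^sup>2 + |w - \<^bold>z\<^sub>k|\<^sup>2 - |z\<^sub>k - \<^bold>z\<^sub>k|\<^sup>2\<close>,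
  where \<open>\<rho>/(\<lambda>h) \<le> 1/12\<close> and, up to noise, \<open>|w - \<^bold>z\<^sub>k| \<le> |z\<^sub>k - \<^bold>z\<^sub>k|/2\<close>, so that a third of
  \<open>h\<^sup>2 |p\<^sub>k|\<^sup>2\<close> is gained up to noise; replacing \<open>w\<close> by \<open>z\<^sub>k\<^sub>+\<^sub>1\<close> costs at most \<open>2 \<Delta> h (\<beta> + S)\<close> in expectation, with
  \<open>\<Delta>\<close> the Euclidean diameter. Telescoping gives
  \<open>h\<^sup>2/3 \<Sum> E|p\<^sub>k|\<^sup>2 \<le> r\<^sub>0\<^sup>2 + (N + 1) (14 h\<^sup>2 (S\<^sup>2 + \<beta>\<^sup>2) + 2 \<Delta> h (\<beta> + S))\<close>,
  and the choices of \<open>t\<close>, \<open>\<mu>\<close> and \<open>N\<close> make the right-hand side small enough.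
\<close>

section \<open>Projected extragradient steps\<close>

lemma bnorm_eq: "lam > 0 \<Longrightarrow> bnorm lam z = sqrt lam * norm z"
  by (simp add: bnorm_def real_sqrt_mult norm_eq_sqrt_inner)

lemma dnorm_eq: "lam > 0 \<Longrightarrow> dnorm lam z = norm z / sqrt lam"
  by (simp add: dnorm_def real_sqrt_mult norm_eq_sqrt_inner real_sqrt_inverse divide_inverse)

text \<open>The norm \<open>bnorm lam\<close> is \<open>sqrt lam\<close> times the Euclidean norm,
  so both problems have the same minimisers. Since \<open>arg_min\<close> is a choice operator,
  uniqueness of the nearest point of a closed convex set is what fixes its value.\<close>

lemma Proj_eq_closest_point:
  fixes Z :: "'a::euclidean_space set"
  assumes "lam > 0" "closed Z" "convex Z" "Z \<noteq> {}"
  shows "Proj lam Z w = closest_point Z w"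
proof -
  have le_iff: "(bnorm lam (x - w))\<^sup>2 < (bnorm lam (y - w))\<^sup>2 \<longleftrightarrow> dist w x < dist w y" for x y
    using assms(1) power_less_imp_less_base[of "norm (x - w)" 2 "norm (y - w)"]
    by (auto simp: bnorm_eq power_mult_distrib dist_norm norm_minus_commute power_strict_mono)
  show ?thesis unfolding Proj_def
  proof (rule arg_minI)
    show "closest_point Z w \<in> Z" using assms by (simp add: closest_point_in_set)
    show "\<not> (bnorm lam (y - w))\<^sup>2 < (bnorm lam (closest_point Z w - w))\<^sup>2" if "y \<in> Z" for y
      using closest_point_le[OF assms(2) that, of w] by (simp add: le_iff)
    show "x = closest_point Z w"
      if "x \<in> Z" "\<forall>y. y \<in> Z \<longrightarrow> \<not> (bnorm lam (y - w))\<^sup>2 < (bnorm lam (x - w))\<^sup>2" for x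
      using that assms by (intro closest_point_unique) (auto simp: le_iff not_less)
  qed
qed

lemma closest_point_nonexpansive:
  fixes Z :: "'a::euclidean_space set"
  assumes "convex Z" "closed Z" "Z \<noteq> {}"
  shows "norm (closest_point Z (v - h *\<^sub>R g) - closest_point Z (v - h *\<^sub>R g')) \<le> \<bar>h\<bar> * norm (g - g')"
proof -
  have "dist (v - h *\<^sub>R g) (v - h *\<^sub>R g') = \<bar>h\<bar> * norm (g - g')"
    by (simp add: dist_norm norm_minus_commute flip: scaleR_diff_right)
  then show ?thesis
    using closest_point_lipschitz[OF assms, of "v - h *\<^sub>R g" "v - h *\<^sub>R g'"] by (simp add: dist_norm)
qed

text \<open>Here x, y, w, P are the lengths of the extrapolation step, of the gap between comparison
  point and extrapolated point, of the comparison step and of the noiseless residual step; q is the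
  noise. For q = 0 the left side is at most (1/4 - 1 + 3/16) x^2 = - 9/16 x^2, which lies below -
  x^2 / 3 with room for the cross terms.\<close>

lemma extragradient_scalar_bound:
  fixes P x y w q :: real
  assumes "0 \<le> x" "0 \<le> y" "0 \<le> w" "0 \<le> q" "0 \<le> P"
    and "y \<le> x / 2 + q" "w \<le> x + y" "P \<le> x + q"
  shows "y\<^sup>2 - x\<^sup>2 + w\<^sup>2 / 12 \<le> - P\<^sup>2 / 3 + 7 * q\<^sup>2"
proof -
  have "y\<^sup>2 \<le> (x / 2 + q)\<^sup>2" "w\<^sup>2 \<le> (3 / 2 * x + q)\<^sup>2" "P\<^sup>2 \<le> (x + q)\<^sup>2"
    using assms by (auto intro!: power_mono)
  then have "y\<^sup>2 \<le> x\<^sup>2 / 4 + x * q + q\<^sup>2" "w\<^sup>2 \<le> 9 / 4 * x\<^sup>2 + 3 * (x * q) + q\<^sup>2"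
    "P\<^sup>2 \<le> x\<^sup>2 + 2 * (x * q) + q\<^sup>2"
    by (simp_all add: power2_eq_square algebra_simps)
  moreover have "0 \<le> (5 * x - 21 * q)\<^sup>2" by simp \<comment> \<open>absorbs the cross term \<open>x * q\<close>\<close>
  then have "0 \<le> 25 * x\<^sup>2 - 210 * (x * q) + 441 * q\<^sup>2"
    by (simp add: power2_eq_square algebra_simps)
  moreover have "0 \<le> x * q" "0 \<le> q\<^sup>2" using assms by auto
  ultimately show ?thesis by linarith
qed

text \<open>The vectors \<open>gh\<close> and \<open>g\<close> are arbitrary, so the bound applies
  pointwise to each realisation of the samples. The error of \<open>gh\<close> enters squared, that
  of \<open>g\<close> only linearly, at the price of the diameter.\<close>

lemma extragradient_step:
  fixes Z :: "'a::euclidean_space set" and L h r Delta :: real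
  assumes Z: "convex Z" "closed Z" "z \<in> Z" "zs \<in> Z"
    and diam: "\<And>v w. v \<in> Z \<Longrightarrow> w \<in> Z \<Longrightarrow> norm (v - w) \<le> Delta"
    and h: "h > 0" "L * h \<le> 1 / 2" and r: "r \<le> h / 12"
    and zh: "zh = closest_point Z (z - h *\<^sub>R gh)"
    and lip: "norm (Fzh - Fz) \<le> L * norm (zh - z)"
    and minty: "(1 / h) *\<^sub>R (z - closest_point Z (z - h *\<^sub>R Fzh)) \<bullet> (zh - zs)
        + r / 2 * (norm ((1 / h) *\<^sub>R (z - closest_point Z (z - h *\<^sub>R Fzh))))\<^sup>2 \<ge> 0"
  shows "(norm (closest_point Z (z - h *\<^sub>R g) - zs))\<^sup>2
      \<le> (norm (z - zs))\<^sup>2 - (norm (z - closest_point Z (z - h *\<^sub>R Fz)))\<^sup>2 / 3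
         + 7 * (h * norm (Fz - gh))\<^sup>2 + 2 * Delta * (h * norm (g - Fzh))"
proof -
  have ne: "Z \<noteq> {}" using Z by auto
  note lipZ = closest_point_nonexpansive[OF Z(1,2) ne]
  define zt where "zt = closest_point Z (z - h *\<^sub>R Fzh)"
  define zp where "zp = closest_point Z (z - h *\<^sub>R g)"
  have in_Z: "zt \<in> Z" "zp \<in> Z" "zh \<in> Z"
    using ne Z(2) by (auto simp: zt_def zp_def zh closest_point_in_set)
  have y: "norm (zt - zh) \<le> norm (z - zh) / 2 + h * norm (Fz - gh)"
  proof -
    have "norm (zt - zh) \<le> h * norm (Fzh - gh)"
      using lipZ[of z h Fzh gh] h by (simp add: zt_def zh)
    also have "\<dots> \<le> h * (norm (Fzh - Fz) + norm (Fz - gh))"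
      using h norm_triangle_ineq[of "Fzh - Fz" "Fz - gh"] by (intro mult_left_mono) auto
    also have "\<dots> \<le> h * (L * norm (zh - z) + norm (Fz - gh))"
      using lip h by (intro mult_left_mono) auto
    also have "\<dots> = (L * h) * norm (z - zh) + h * norm (Fz - gh)"
      by (simp add: algebra_simps norm_minus_commute)
    also have "\<dots> \<le> 1 / 2 * norm (z - zh) + h * norm (Fz - gh)"
      using h by (intro add_right_mono mult_right_mono) auto
    finally show ?thesis by simp
  qed
  have w: "norm (z - zt) \<le> norm (z - zh) + norm (zt - zh)"
    using norm_triangle_ineq4[of "z - zh" "zt - zh"] by simp
  have P: "norm (z - closest_point Z (z - h *\<^sub>R Fz)) \<le> norm (z - zh) + h * norm (Fz - gh)"
    using lipZ[of z h gh Fz] h norm_triangle_ineq[of "z - zh" "zh - closest_point Z (z - h *\<^sub>R Fz)"]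
    by (simp add: zh norm_minus_commute)
  \<comment> \<open>The Minty inequality times \<open>2 * h\<close>: its correction becomes
    \<open>r / h\<close> times the squared step, and \<open>r / h\<close> is at most 1/12.\<close>
  have m: "2 * ((z - zt) \<bullet> (zh - zs)) \<ge> - (norm (z - zt))\<^sup>2 / 12"
  proof -
    have "0 \<le> 1 / h * ((z - zt) \<bullet> (zh - zs)) + r / 2 * ((norm (z - zt))\<^sup>2 / h\<^sup>2)"
      using minty h by (simp add: zt_def power_divide)
    also have "r / 2 * ((norm (z - zt))\<^sup>2 / h\<^sup>2) \<le> (h / 12) / 2 * ((norm (z - zt))\<^sup>2 / h\<^sup>2)"
      using r by (intro mult_right_mono) auto
    finally show ?thesis using h by (simp add: field_simps power2_eq_square)
  qed
  \<comment> \<open>Expanding both squared norms around \<open>zh\<close> leaves exactly the inner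
    product that \<open>m\<close> controls.\<close>
  have "(norm (zt - zs))\<^sup>2 = (norm (z - zs))\<^sup>2 - 2 * ((z - zt) \<bullet> (zh - zs))
      + (norm (zt - zh))\<^sup>2 - (norm (z - zh))\<^sup>2"
    unfolding power2_norm_eq_inner by (simp add: algebra_simps inner_commute)
  also have "\<dots> \<le> (norm (z - zs))\<^sup>2 + ((norm (zt - zh))\<^sup>2 - (norm (z - zh))\<^sup>2 + (norm (z - zt))\<^sup>2 / 12)"
    using m by simp
  also have "\<dots> \<le> (norm (z - zs))\<^sup>2 +
      (- (norm (z - closest_point Z (z - h *\<^sub>R Fz)))\<^sup>2 / 3 + 7 * (h * norm (Fz - gh))\<^sup>2)"
    using y w P h by (intro add_left_mono extragradient_scalar_bound) auto
  finally have zt_bd: "(norm (zt - zs))\<^sup>2 \<le> \<dots>" .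
  \<comment> \<open>Factoring the difference of squares keeps the update noise linear, so that only
    its first moment is needed later.\<close>
  have "(norm (zp - zs))\<^sup>2 - (norm (zt - zs))\<^sup>2 = (zp - zt) \<bullet> ((zp - zs) + (zt - zs))"
    unfolding power2_norm_eq_inner by (simp add: algebra_simps inner_commute)
  also have "\<dots> \<le> norm (zp - zt) * norm ((zp - zs) + (zt - zs))"
    by (rule norm_cauchy_schwarz)
  also have "\<dots> \<le> (h * norm (g - Fzh)) * (2 * Delta)"
  proof (rule mult_mono)
    show "norm (zp - zt) \<le> h * norm (g - Fzh)"
      using lipZ[of z h g Fzh] h by (simp add: zt_def zp_def)
    show "norm ((zp - zs) + (zt - zs)) \<le> 2 * Delta"
      using norm_triangle_ineq[of "zp - zs" "zt - zs"] diam in_Z Z(4) by (smt (verit))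
  qed (use h in auto)
  finally show ?thesis using zt_bd by (simp add: zp_def algebra_simps)
qed

section \<open>Gradients and the saddle operator\<close>

text \<open>The Riesz vector of the derivative, with coordinates \<open>f' b\<close>, is a gradient;
  uniqueness of the derivative lets the definite description in \<open>grad\<close> select
  it.\<close>

lemma GDERIV_grad:
  fixes f :: "'a::euclidean_space \<Rightarrow> real"
  assumes "f differentiable (at v)"
  shows "GDERIV f v :> grad f v"
proof -
  obtain f' where f': "(f has_derivative f') (at v)"
    using assms by (auto simp: differentiable_def)
  then have lin: "linear f'" by (rule has_derivative_linear)
  have "f' = (\<lambda>w. w \<bullet> (\<Sum>b\<in>Basis. f' b *\<^sub>R b))"
  proof
    fix w show "f' w = w \<bullet> (\<Sum>b\<in>Basis. f' b *\<^sub>R b)"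
      using linear_sum[OF lin, of "\<lambda>b. (w \<bullet> b) *\<^sub>R b" Basis]
      by (simp add: euclidean_representation linear_cmul[OF lin] inner_sum_right mult.commute)
  qed
  with f' have "GDERIV f v :> (\<Sum>b\<in>Basis. f' b *\<^sub>R b)" unfolding gderiv_def by simp
  then show ?thesis unfolding grad_def
  proof (rule theI)
    fix g assume "GDERIV f v :> g"
    then have "(\<lambda>w. w \<bullet> g) = f'"
      using f' unfolding gderiv_def by (rule has_derivative_unique)
    then have "w \<bullet> g = w \<bullet> (\<Sum>b\<in>Basis. f' b *\<^sub>R b)" for w
      using \<open>f' = _\<close> by metis
    then show "g = (\<Sum>b\<in>Basis. f' b *\<^sub>R b)"
      by (metis euclidean_eqI inner_commute)
  qed
qed

lemma grad_eqI:
  fixes f :: "'a::euclidean_space \<Rightarrow> real"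
  assumes "GDERIV f v :> g"
  shows "grad f v = g"
proof -
  have "f differentiable (at v)" using assms unfolding gderiv_def differentiable_def by auto
  from GDERIV_grad[OF this] have "(\<lambda>w. w \<bullet> grad f v) = (\<lambda>w. w \<bullet> g)"
    using assms unfolding gderiv_def by (rule has_derivative_unique)
  then have "w \<bullet> grad f v = w \<bullet> g" for w by metis
  then show ?thesis by (metis euclidean_eqI inner_commute)
qed

text \<open>The isometric reflection that turns the gradient into the saddle operator and a sample
  into the direction of the oracle; norm bounds pass through it unchanged.\<close>

definition conj_pair :: "'a \<times> 'b::ab_group_add \<Rightarrow> 'a \<times> 'b" where
  "conj_pair v = (fst v, - snd v)"

lemma norm_conj_pair [simp]:
  fixes v :: "'a::real_inner \<times> 'b::real_inner"
  shows "norm (conj_pair v) = norm v"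
  by (simp add: conj_pair_def norm_prod_def)

text \<open>The chain rule along the two affine slices through \<open>v\<close> identifies the
  partial gradients with the components of the full gradient.\<close>

lemma saddle_op_eq_grad:
  fixes f :: "'a::euclidean_space \<times> 'b::euclidean_space \<Rightarrow> real"
  assumes "f differentiable (at v)"
  shows "saddle_op f v = conj_pair (grad f v)"
proof -
  have D: "(f has_derivative (\<lambda>w. w \<bullet> grad f v)) (at (fst v, snd v))"
    using GDERIV_grad[OF assms] by (simp add: gderiv_def)
  have "((\<lambda>x. f (x, snd v)) has_derivative (\<lambda>x. (x, 0) \<bullet> grad f v)) (at (fst v))"
    by (rule has_derivative_compose[where f = "\<lambda>x. (x, snd v)" and g = f, OF _ D])
       (auto intro!: derivative_eq_intros)
  then have 1: "grad (\<lambda>x. f (x, snd v)) (fst v) = fst (grad f v)"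
    by (intro grad_eqI) (simp add: gderiv_def inner_prod_def)
  have "((\<lambda>y. f (fst v, y)) has_derivative (\<lambda>y. (0, y) \<bullet> grad f v)) (at (snd v))"
    by (rule has_derivative_compose[where f = "\<lambda>y. (fst v, y)" and g = f, OF _ D])
       (auto intro!: derivative_eq_intros)
  then have "grad (\<lambda>y. f (fst v, y)) (snd v) = snd (grad f v)"
    by (intro grad_eqI) (simp add: gderiv_def inner_prod_def)
  with 1 show ?thesis by (simp add: saddle_op_def conj_pair_def)
qed

lemma saddle_op_lipschitz:
  fixes f :: "'a::euclidean_space \<times> 'b::euclidean_space \<Rightarrow> real"
  assumes diff: "\<And>v. f differentiable (at v)"
    and lip: "\<And>v w. norm (grad f v - grad f w) \<le> L * norm (v - w)"
  shows "norm (saddle_op f v - saddle_op f w) \<le> L * norm (v - w)"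
proof -
  have "saddle_op f v - saddle_op f w = conj_pair (grad f v - grad f w)"
    by (simp add: saddle_op_eq_grad[OF diff] conj_pair_def)
  then show ?thesis using lip[of v w] by simp
qed

text \<open>The mean value theorem along the segment, then the Lipschitz bound. It yields the
  constant \<open>L\<close> instead of the sharp \<open>L / 2\<close>, a loss that the final
  arithmetic absorbs.\<close>

lemma first_order_error:
  fixes f :: "'a::euclidean_space \<Rightarrow> real"
  assumes diff: "\<And>v. f differentiable (at v)"
    and lip: "\<And>v w. norm (grad f v - grad f w) \<le> L * norm (v - w)"
    and L: "L \<ge> 0"
  shows "\<bar>f (v + w) - f v - grad f v \<bullet> w\<bar> \<le> L * (norm w)\<^sup>2"
proof -
  have "\<exists>s>0. s < 1 \<and> f (v + 1 *\<^sub>R w) - f (v + 0 *\<^sub>R w) = (1 - 0) * (w \<bullet> grad f (v + s *\<^sub>R w))"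
  proof (rule MVT2)
    fix s :: real
    have D: "(f has_derivative (\<lambda>u. u \<bullet> grad f (v + s *\<^sub>R w))) (at (v + s *\<^sub>R w))"
      using GDERIV_grad[OF diff] by (simp add: gderiv_def)
    have "((\<lambda>s. f (v + s *\<^sub>R w)) has_derivative (\<lambda>s'. (s' *\<^sub>R w) \<bullet> grad f (v + s *\<^sub>R w))) (at s)"
      by (rule has_derivative_compose[where f = "\<lambda>s. v + s *\<^sub>R w" and g = f, OF _ D])
         (auto intro!: derivative_eq_intros)
    then show "((\<lambda>s. f (v + s *\<^sub>R w)) has_field_derivative w \<bullet> grad f (v + s *\<^sub>R w)) (at s)"
      by (simp add: has_field_derivative_def mult_commute_abs)
  qed simp
  then obtain s where s: "0 < s" "s < 1" "f (v + w) - f v = w \<bullet> grad f (v + s *\<^sub>R w)" by auto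
  then have "\<bar>f (v + w) - f v - grad f v \<bullet> w\<bar> = \<bar>(grad f (v + s *\<^sub>R w) - grad f v) \<bullet> w\<bar>"
    by (simp add: inner_diff_left inner_commute[of w])
  also have "\<dots> \<le> norm (grad f (v + s *\<^sub>R w) - grad f v) * norm w"
    by (rule Cauchy_Schwarz_ineq2)
  also have "\<dots> \<le> (L * norm (s *\<^sub>R w)) * norm w"
    using lip[of "v + s *\<^sub>R w" v] by (intro mult_right_mono) auto
  also have "\<dots> = s * (L * (norm w)\<^sup>2)" using s by (simp add: power2_eq_square)
  also have "\<dots> \<le> 1 * (L * (norm w)\<^sup>2)" using s L by (intro mult_right_mono) auto
  finally show ?thesis by simp
qed

section \<open>Gaussian moments\<close>

text \<open>An isotropic Gaussian has independent normal coordinates of standard deviation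
  \<open>1 / sqrt lam\<close>, which reduces its moments to one dimension.\<close>

lemma gauss_density_eq_prod:
  assumes "lam > 0"
  shows "gauss_density lam (u :: 'a::euclidean_space) = (\<Prod>b\<in>Basis. normal_density 0 (1 / sqrt lam) (u \<bullet> b))"
proof -
  have "(bnorm lam u)\<^sup>2 = (\<Sum>b\<in>Basis. lam * (u \<bullet> b)\<^sup>2)"
    using assms by (simp add: bnorm_eq power_mult_distrib power2_norm_eq_inner
        euclidean_inner[of u u] sum_distrib_left power2_eq_square[of "u \<bullet> _"])
  then have "exp (- (bnorm lam u)\<^sup>2 / 2) = (\<Prod>b\<in>Basis. exp (- (lam * (u \<bullet> b)\<^sup>2) / 2))"
    by (simp add: sum_negf sum_divide_distrib flip: exp_sum)
  moreover have "sqrt (lam ^ DIM('a) / (2 * pi) ^ DIM('a)) = (\<Prod>b\<in>(Basis::'a set). sqrt (lam / (2 * pi)))"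
    by (simp add: power_divide power_mult_distrib flip: real_sqrt_power)
  moreover have "normal_density 0 (1 / sqrt lam) x = sqrt (lam / (2 * pi)) * exp (- (lam * x\<^sup>2) / 2)" for x
    using assms by (simp add: normal_density_def power_divide real_sqrt_divide mult.commute)
  ultimately show ?thesis
    unfolding gauss_density_def by (simp only: prod.distrib)
qed

lemma borel_measurable_gauss_density [measurable]:
  "gauss_density lam \<in> borel_measurable (borel :: 'a::euclidean_space measure)"
proof -
  have "continuous_on UNIV (gauss_density lam :: 'a \<Rightarrow> real)"
    unfolding gauss_density_def[abs_def] bnorm_def by (intro continuous_intros) auto
  then show ?thesis by (rule borel_measurable_continuous_onI)
qed

lemma gauss_density_nonneg: "gauss_density lam u \<ge> 0" if "lam > 0"
  using that by (simp add: gauss_density_def)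

lemma space_gauss [simp]: "space (gauss lam) = UNIV"
  and sets_gauss [simp, measurable_cong]: "sets (gauss lam) = sets borel"
  by (simp_all add: gauss_def)

text \<open>Lebesgue measure is the image of the product measure under the coordinate map, so Fubini
  splits the integral once the density is factored.\<close>

lemma gauss_integral_prod:
  fixes g :: "'a::euclidean_space \<Rightarrow> real \<Rightarrow> real"
  assumes lam: "lam > 0" and [measurable]: "\<And>b. g b \<in> borel_measurable borel"
    and int: "\<And>b. b \<in> Basis \<Longrightarrow> integrable lborel (\<lambda>x. normal_density 0 (1 / sqrt lam) x * g b x)"
  shows "integrable (gauss lam) (\<lambda>u::'a. \<Prod>b\<in>Basis. g b (u \<bullet> b))" (is ?int)
    and "(\<integral>u. (\<Prod>b\<in>Basis. g b (u \<bullet> b)) \<partial>gauss lam)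
      = (\<Prod>b\<in>(Basis::'a set). \<integral>x. normal_density 0 (1 / sqrt lam) x * g b x \<partial>lborel)" (is ?eq)
proof -
  let ?n = "normal_density 0 (1 / sqrt lam)"
  interpret product_sigma_finite "\<lambda>_::'a. lborel :: real measure" ..
  have [measurable]: "(\<lambda>u::'a. \<Prod>b\<in>Basis. ?n (u \<bullet> b) * g b (u \<bullet> b)) \<in> borel_measurable borel" by measurable
  have repr: "(\<Sum>b\<in>Basis. x b *\<^sub>R b) \<bullet> c = x c" if "c \<in> Basis" for x :: "'a \<Rightarrow> real" and c
    using that by simp
  have dens: "gauss_density lam u * (\<Prod>b\<in>Basis. g b (u \<bullet> b)) = (\<Prod>b\<in>Basis. ?n (u \<bullet> b) * g b (u \<bullet> b))" for u :: 'a
    by (simp add: gauss_density_eq_prod[OF lam] prod.distrib)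
  have pint: "integrable (\<Pi>\<^sub>M b\<in>(Basis::'a set). lborel) (\<lambda>x. \<Prod>b\<in>Basis. ?n (x b) * g b (x b))"
    by (rule product_integrable_prod) (auto intro: int)
  have "integrable lborel (\<lambda>u::'a. \<Prod>b\<in>Basis. ?n (u \<bullet> b) * g b (u \<bullet> b))"
    using pint by (simp add: lborel_eq[where 'a='a] integrable_distr_eq repr cong: prod.cong)
  then show ?int
    using gauss_density_nonneg[OF lam] by (subst gauss_def, subst integrable_density) (auto simp: dens)
  have "(\<integral>u. (\<Prod>b\<in>Basis. g b (u \<bullet> b)) \<partial>gauss lam) = (\<integral>u. (\<Prod>b\<in>Basis. ?n (u \<bullet> b) * g b (u \<bullet> b)) \<partial>(lborel :: 'a measure))"
    using gauss_density_nonneg[OF lam] by (subst gauss_def, subst integral_density) (auto simp: dens)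
  also have "\<dots> = (\<integral>x. (\<Prod>b\<in>Basis. ?n (x b) * g b (x b)) \<partial>(\<Pi>\<^sub>M b\<in>(Basis::'a set). lborel))"
    by (simp add: lborel_eq[where 'a='a] integral_distr repr cong: prod.cong)
  also have "\<dots> = (\<Prod>b\<in>(Basis::'a set). \<integral>x. ?n x * g b x \<partial>lborel)"
    by (rule product_integral_prod) (auto intro: int)
  finally show ?eq .
qed

lemma gauss_coord_power:
  assumes lam: "lam > 0" and b: "(b::'a::euclidean_space) \<in> Basis"
  shows "integrable (gauss lam) (\<lambda>u::'a. (u \<bullet> b) ^ k)"
    and "(\<integral>u. (u \<bullet> b) ^ k \<partial>gauss lam) = (\<integral>x. normal_density 0 (1 / sqrt lam) x * x ^ k \<partial>lborel)"
proof -
  \<comment> \<open>All factors except the one at \<open>b\<close> are 1 and integrate to 1 against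
    their normal densities.\<close>
  define g :: "'a \<Rightarrow> real \<Rightarrow> real" where "g = (\<lambda>c x. if c = b then x ^ k else 1)"
  have s: "1 / sqrt lam > 0" using lam by simp
  have [measurable]: "g c \<in> borel_measurable borel" for c unfolding g_def by measurable
  have int: "integrable lborel (\<lambda>x. normal_density 0 (1 / sqrt lam) x * g c x)" for c
    using integrable_normal_moment[OF s, of 0 k] integrable_normal_density[OF s, of 0]
    by (cases "c = b") (simp_all add: g_def)
  have eq: "(\<Prod>c\<in>Basis. g c (u \<bullet> c)) = (u \<bullet> b) ^ k" for u :: 'a
    using b by (simp add: g_def prod.delta)
  show "integrable (gauss lam) (\<lambda>u::'a. (u \<bullet> b) ^ k)"
    using gauss_integral_prod(1)[where g = g, OF lam _ int] by (simp add: eq)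
  have "(\<integral>u. (u \<bullet> b) ^ k \<partial>gauss lam)
      = (\<Prod>c\<in>(Basis::'a set). \<integral>x. normal_density 0 (1 / sqrt lam) x * g c x \<partial>lborel)"
    using gauss_integral_prod(2)[where g = g, OF lam _ int] by (simp add: eq)
  also have "\<dots> = (\<Prod>c\<in>(Basis::'a set). if c = b then \<integral>x. normal_density 0 (1 / sqrt lam) x * x ^ k \<partial>lborel else 1)"
    using integral_normal_density[OF s, of 0] by (intro prod.cong) (auto simp: g_def)
  finally show "(\<integral>u. (u \<bullet> b) ^ k \<partial>gauss lam) = (\<integral>x. normal_density 0 (1 / sqrt lam) x * x ^ k \<partial>lborel)"
    using b by (simp add: prod.delta)
qed

lemma gauss_coord_moments:
  assumes lam: "lam > 0" and b: "(b::'a::euclidean_space) \<in> Basis"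
  shows "(\<integral>u. (u \<bullet> b)\<^sup>2 \<partial>gauss lam) = 1 / lam" and "(\<integral>u. (u \<bullet> b) ^ 4 \<partial>gauss lam) = 3 / lam\<^sup>2"
proof -
  have s: "1 / sqrt lam > 0" using lam by simp
  show "(\<integral>u. (u \<bullet> b)\<^sup>2 \<partial>gauss lam) = 1 / lam" "(\<integral>u. (u \<bullet> b) ^ 4 \<partial>gauss lam) = 3 / lam\<^sup>2"
    unfolding gauss_coord_power(2)[OF lam b]
    using integral_normal_moment_even[OF s, of 0 1] integral_normal_moment_even[OF s, of 0 2] lam
    by (simp_all add: power_divide fact_numeral)
qed

lemma gauss_coord_uncorrelated:
  assumes lam: "lam > 0" and b: "(b::'a::euclidean_space) \<in> Basis" "c \<in> Basis" "b \<noteq> c"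
  shows "(\<integral>u. (u \<bullet> b) * (u \<bullet> c) \<partial>gauss lam) = 0"
proof -
  \<comment> \<open>Written as two guarded factors so that each collapses separately in the product
    over the basis; the factor at \<open>b\<close> has mean zero.\<close>
  define g :: "'a \<Rightarrow> real \<Rightarrow> real" where "g = (\<lambda>i x. (if i = b then x else 1) * (if i = c then x else 1))"
  have s: "1 / sqrt lam > 0" using lam by simp
  have [measurable]: "g i \<in> borel_measurable borel" for i unfolding g_def by measurable
  have int: "integrable lborel (\<lambda>x. normal_density 0 (1 / sqrt lam) x * g i x)" for i
    using integrable_normal_moment[OF s, of 0 1] integrable_normal_density[OF s, of 0] b
    by (cases "i = b"; cases "i = c") (simp_all add: g_def)
  have "(\<Prod>i\<in>Basis. g i (u \<bullet> i)) = (u \<bullet> b) * (u \<bullet> c)" for u :: 'a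
    using b by (simp add: g_def prod.distrib prod.delta)
  then have "(\<integral>u. (u \<bullet> b) * (u \<bullet> c) \<partial>gauss lam)
      = (\<Prod>i\<in>(Basis::'a set). \<integral>x. normal_density 0 (1 / sqrt lam) x * g i x \<partial>lborel)"
    using gauss_integral_prod(2)[where g = g, OF lam _ int] by simp
  moreover have "(\<integral>x. normal_density 0 (1 / sqrt lam) x * g b x \<partial>lborel) = 0"
    using integral_normal_moment_nz_1[OF s, of 0] b by (simp add: g_def)
  ultimately show ?thesis using b by (auto intro!: prod_zero)
qed

text \<open>The total mass is the zeroth moment of any coordinate.\<close>

lemma prob_space_gauss:
  assumes "lam > 0"
  shows "prob_space (gauss lam :: 'a::euclidean_space measure)"
proof (rule prob_spaceI)
  obtain b :: 'a where b: "b \<in> Basis" using nonempty_Basis by blast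
  have s: "1 / sqrt lam > 0" using assms by simp
  have "(\<integral>\<^sup>+u. ennreal 1 \<partial>(gauss lam :: 'a measure)) = ennreal (\<integral>u. 1 \<partial>(gauss lam :: 'a measure))"
    using gauss_coord_power(1)[OF assms b, of 0] by (intro nn_integral_eq_integral) auto
  also have "\<dots> = 1"
    using gauss_coord_power(2)[OF assms b, of 0] integral_normal_density[OF s, of 0] by simp
  finally show "emeasure (gauss lam :: 'a measure) (space (gauss lam)) = 1" by simp
qed

text \<open>The norm is at most the dimension times the largest coordinate. The constant is crude,
  but serves only for integrability.\<close>

lemma norm_power_le_sum_coord_power:
  fixes u :: "'a::euclidean_space"
  shows "norm u ^ k \<le> real DIM('a) ^ k * (\<Sum>b\<in>Basis. \<bar>(u \<bullet> b) ^ k\<bar>)"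
proof -
  define A where "A = (\<lambda>b. \<bar>u \<bullet> b\<bar>) ` (Basis :: 'a set)"
  have "Max A \<in> A" by (intro Max_in) (auto simp: A_def)
  then have "\<exists>c\<in>Basis. Max A = \<bar>u \<bullet> c\<bar>" unfolding A_def by (simp only: image_iff)
  then obtain c where "c \<in> Basis" "Max A = \<bar>u \<bullet> c\<bar>" by blast
  then have c: "c \<in> Basis" "\<And>b. b \<in> Basis \<Longrightarrow> \<bar>u \<bullet> b\<bar> \<le> \<bar>u \<bullet> c\<bar>"
    using Max_ge[of A] by (auto simp: A_def)
  have "norm u \<le> (\<Sum>b\<in>Basis. \<bar>u \<bullet> b\<bar>)" by (rule norm_le_l1)
  also have "\<dots> \<le> real DIM('a) * \<bar>u \<bullet> c\<bar>" using c(2) by (rule sum_bounded_above)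
  finally have "norm u ^ k \<le> (real DIM('a) * \<bar>u \<bullet> c\<bar>) ^ k" by (intro power_mono) auto
  also have "\<dots> = real DIM('a) ^ k * \<bar>(u \<bullet> c) ^ k\<bar>" by (simp add: power_mult_distrib power_abs)
  also have "\<dots> \<le> real DIM('a) ^ k * (\<Sum>b\<in>Basis. \<bar>(u \<bullet> b) ^ k\<bar>)"
    using c(1) by (intro mult_left_mono member_le_sum) auto
  finally show ?thesis .
qed

lemma integrable_gauss_norm_power:
  assumes "lam > 0"
  shows "integrable (gauss lam) (\<lambda>u::'a::euclidean_space. norm u ^ k)"
proof (rule Bochner_Integration.integrable_bound)
  show "integrable (gauss lam) (\<lambda>u::'a. real DIM('a) ^ k * (\<Sum>b\<in>Basis. \<bar>(u \<bullet> b) ^ k\<bar>))"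
    by (intro integrable_mult_right Bochner_Integration.integrable_sum integrable_abs gauss_coord_power(1) assms)
  show "AE u in (gauss lam :: 'a measure). norm (norm u ^ k)
      \<le> norm (real DIM('a) ^ k * (\<Sum>b\<in>Basis. \<bar>(u \<bullet> b) ^ k\<bar>))"
    using norm_power_le_sum_coord_power[where 'a = 'a]
    by (intro always_eventually allI) (simp add: sum_nonneg abs_mult)
qed simp

lemma gauss_norm_moments:
  fixes lam :: real
  assumes lam: "lam > 0"
  shows "(\<integral>u. (norm u)\<^sup>2 \<partial>(gauss lam :: 'a::euclidean_space measure)) = DIM('a) / lam"
    and "(\<integral>u. norm u ^ 4 \<partial>(gauss lam :: 'a measure)) \<le> 3 * (DIM('a) / lam)\<^sup>2"
    and "(\<integral>u. norm u ^ 3 \<partial>(gauss lam :: 'a measure)) \<le> sqrt 3 * sqrt (DIM('a) / lam) ^ 3"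
proof -
  have sq: "(norm u)\<^sup>2 = (\<Sum>b\<in>Basis. (u \<bullet> b)\<^sup>2)" for u :: 'a
    unfolding power2_norm_eq_inner euclidean_inner[of u u] by (simp add: power2_eq_square)
  show 2: "(\<integral>u. (norm u)\<^sup>2 \<partial>(gauss lam :: 'a measure)) = DIM('a) / lam"
    unfolding sq by (subst Bochner_Integration.integral_sum)
      (simp_all add: gauss_coord_power(1)[OF lam] gauss_coord_moments(1)[OF lam])
  \<comment> \<open>Cauchy-Schwarz over the coordinates reduces the fourth moment of the norm to
    those of single coordinates.\<close>
  have 4: "norm u ^ 4 \<le> DIM('a) * (\<Sum>b\<in>Basis. (u \<bullet> b) ^ 4)" for u :: 'a
  proof -
    have "norm u ^ 4 = (\<Sum>b\<in>Basis. (u \<bullet> b)\<^sup>2)\<^sup>2" by (simp flip: sq add: power_mult[symmetric])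
    also have "\<dots> \<le> (\<Sum>b\<in>Basis. ((u \<bullet> b)\<^sup>2)\<^sup>2) * DIM('a)"
      by (rule sum_squared_le_sum_of_squares)
    finally show ?thesis by (simp add: mult.commute flip: power_mult)
  qed
  have "(\<integral>u. norm u ^ 4 \<partial>(gauss lam :: 'a measure)) \<le> (\<integral>u. DIM('a) * (\<Sum>b\<in>Basis. (u \<bullet> b) ^ 4) \<partial>(gauss lam :: 'a measure))"
    using 4 by (intro integral_mono integrable_gauss_norm_power lam integrable_mult_right
        Bochner_Integration.integrable_sum gauss_coord_power(1))
  also have "\<dots> = 3 * (DIM('a) / lam)\<^sup>2"
    by (simp, subst Bochner_Integration.integral_sum)
      (simp_all add: gauss_coord_power(1)[OF lam] gauss_coord_moments(2)[OF lam] power2_eq_square)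
  finally show m4: "(\<integral>u. norm u ^ 4 \<partial>(gauss lam :: 'a measure)) \<le> 3 * (DIM('a) / lam)\<^sup>2" .
  define s where "s = sqrt (DIM('a) / lam)"
  have s: "s > 0" "DIM('a) / lam = s\<^sup>2" using lam by (simp_all add: s_def)
  \<comment> \<open>The third moment is interpolated between the second and the fourth by a weighted
    AM-GM. This weight is the square root of the ratio of the bounds \<open>3 * s ^ 4\<close> and
    \<open>s ^ 2\<close>, for which the two terms balance.\<close>
  define r where "r = sqrt 3 * s"
  have r: "r > 0" using s by (simp add: r_def)
  have "norm u ^ 3 \<le> (r * (norm u)\<^sup>2 + norm u ^ 4 / r) / 2" for u :: 'a
  proof -
    have "0 \<le> (norm u)\<^sup>2 * (r - norm u)\<^sup>2 / r" using r by simp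
    also have "\<dots> = r * (norm u)\<^sup>2 + norm u ^ 4 / r - 2 * norm u ^ 3"
      using r by (simp add: field_simps power2_eq_square power3_eq_cube power4_eq_xxxx)
    finally show ?thesis by simp
  qed
  then have "(\<integral>u. norm u ^ 3 \<partial>(gauss lam :: 'a measure)) \<le> (\<integral>u. (r * (norm u)\<^sup>2 + norm u ^ 4 / r) / 2 \<partial>(gauss lam :: 'a measure))"
    by (intro integral_mono integrable_gauss_norm_power lam integrable_mult_right
        Bochner_Integration.integrable_add integrable_divide)
  also have "\<dots> = (r * s\<^sup>2 + (\<integral>u. norm u ^ 4 \<partial>(gauss lam :: 'a measure)) / r) / 2"
    using integrable_gauss_norm_power[OF lam, where 'a = 'a] by (simp add: 2 s(2))
  also have "\<dots> \<le> (r * s\<^sup>2 + (3 * (s\<^sup>2)\<^sup>2) / r) / 2"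
    using m4 r s(2) by (intro divide_right_mono add_left_mono) auto
  also have "\<dots> = sqrt 3 * s ^ 3"
  proof -
    have "3 * (s\<^sup>2)\<^sup>2 = r * (sqrt 3 * s ^ 3)"
      by (simp add: r_def power2_eq_square power3_eq_cube)
    then have "3 * (s\<^sup>2)\<^sup>2 / r = sqrt 3 * s ^ 3" using r by (simp only:) simp
    moreover have "r * s\<^sup>2 = sqrt 3 * s ^ 3" by (simp add: r_def power2_eq_square power3_eq_cube)
    ultimately show ?thesis by simp
  qed
  finally show "(\<integral>u. norm u ^ 3 \<partial>(gauss lam :: 'a measure)) \<le> sqrt 3 * sqrt (DIM('a) / lam) ^ 3"
    by (simp add: s_def)
qed

text \<open>The covariance is the identity divided by \<open>lam\<close>; this makes the linear part
  of the oracle unbiased.\<close>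

lemma gauss_inner_scaleR:
  assumes lam: "lam > 0"
  shows "integrable (gauss lam) (\<lambda>u::'a::euclidean_space. (v \<bullet> u) *\<^sub>R u)"
    and "(\<integral>u. (v \<bullet> u) *\<^sub>R u \<partial>(gauss lam :: 'a measure)) = (1 / lam) *\<^sub>R v"
proof -
  show int: "integrable (gauss lam) (\<lambda>u::'a. (v \<bullet> u) *\<^sub>R u)"
  proof (rule Bochner_Integration.integrable_bound)
    show "integrable (gauss lam) (\<lambda>u::'a. norm v * (norm u)\<^sup>2)"
      by (intro integrable_mult_right integrable_gauss_norm_power lam)
    show "AE u in gauss lam. norm ((v \<bullet> u) *\<^sub>R u) \<le> norm (norm v * (norm u)\<^sup>2)"
      using Cauchy_Schwarz_ineq2[of v]
      by (intro always_eventually allI) (simp add: power2_eq_square mult_right_mono flip: mult.assoc)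
  qed simp
  show "(\<integral>u. (v \<bullet> u) *\<^sub>R u \<partial>(gauss lam :: 'a measure)) = (1 / lam) *\<^sub>R v"
  proof (rule euclidean_eqI)
    fix b :: 'a assume b: "b \<in> Basis"
    have prod_int: "integrable (gauss lam) (\<lambda>u::'a. (u \<bullet> c) * (u \<bullet> b))" if "c \<in> Basis" for c
    proof (rule Bochner_Integration.integrable_bound)
      show "integrable (gauss lam) (\<lambda>u::'a. (norm u)\<^sup>2)" by (rule integrable_gauss_norm_power[OF lam])
      show "AE u in gauss lam. norm ((u \<bullet> c) * (u \<bullet> b)) \<le> norm ((norm u)\<^sup>2)"
        using Basis_le_norm[OF that] Basis_le_norm[OF b]
        by (intro always_eventually allI) (auto simp: power2_eq_square abs_mult intro!: mult_mono)
    qed simp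
    have "(\<integral>u. (v \<bullet> u) *\<^sub>R u \<partial>(gauss lam :: 'a measure)) \<bullet> b = (\<integral>u. (v \<bullet> u) * (u \<bullet> b) \<partial>(gauss lam :: 'a measure))"
      by (subst integral_inner_left[symmetric]) (simp_all add: int)
    also have "\<dots> = (\<integral>u. (\<Sum>c\<in>Basis. (v \<bullet> c) * ((u \<bullet> c) * (u \<bullet> b))) \<partial>gauss lam)"
      by (subst euclidean_inner) (simp add: sum_distrib_right mult.assoc)
    also have "\<dots> = (\<Sum>c\<in>Basis. (v \<bullet> c) * (\<integral>u. (u \<bullet> c) * (u \<bullet> b) \<partial>gauss lam))"
      using prod_int by simp
    also have "\<dots> = (\<Sum>c\<in>Basis. if c = b then (v \<bullet> b) / lam else 0)"
      using gauss_coord_uncorrelated[OF lam _ b] gauss_coord_moments(1)[OF lam b]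
      by (intro sum.cong) (auto simp: power2_eq_square)
    finally show "(\<integral>u. (v \<bullet> u) *\<^sub>R u \<partial>(gauss lam :: 'a measure)) \<bullet> b = ((1 / lam) *\<^sub>R v) \<bullet> b"
      using b by simp
  qed
qed

section \<open>Bias and variance of the oracle\<close>

lemma bounded_linear_conj_pair:
  "bounded_linear (conj_pair :: 'a::real_inner \<times> 'b::real_inner \<Rightarrow> 'a \<times> 'b)"
proof (rule bounded_linear_intro)
  show "norm (conj_pair v) \<le> norm v * 1" for v :: "'a \<times> 'b" by simp
qed (simp_all add: conj_pair_def)

lemma oracle_G_eq: "oracle_G lam mu f z u = ((f (z + mu *\<^sub>R u) - f z) / mu * lam) *\<^sub>R conj_pair u"
  by (simp add: oracle_G_def conj_pair_def)

locale smooth_oracle =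
  fixes f :: "'a::euclidean_space \<times> 'b::euclidean_space \<Rightarrow> real" and lam mu L :: real
  assumes lam: "lam > 0" and mu: "mu > 0" and L: "L \<ge> 0"
    and diff: "\<And>v. f differentiable (at v)"
    and lip: "\<And>v w. norm (grad f v - grad f w) \<le> L * norm (v - w)"
begin

lemma borel_measurable_objective: "f \<in> borel_measurable borel"
  using diff by (intro borel_measurable_continuous_onI)
    (auto simp: continuous_on_eq_continuous_within intro: differentiable_imp_continuous_within)

lemma borel_measurable_oracle_G [measurable (raw)]:
  assumes [measurable]: "g \<in> borel_measurable N" "k \<in> borel_measurable N"
  shows "(\<lambda>x. oracle_G lam mu f (g x) (k x)) \<in> borel_measurable N"
proof -
  note borel_measurable_objective [measurable]
  have [measurable]: "(conj_pair :: 'a \<times> 'b \<Rightarrow> 'a \<times> 'b) \<in> borel_measurable borel"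
    by (intro borel_measurable_continuous_onI linear_continuous_on bounded_linear_conj_pair)
  show ?thesis unfolding oracle_G_eq[abs_def] by measurable
qed

text \<open>The first-order error of \<open>f\<close> at step \<open>mu * u\<close> is quadratic in
  \<open>mu\<close>; the oracle divides it by \<open>mu\<close> and multiplies it by
  \<open>lam\<close> and the length of \<open>u\<close>.\<close>

lemma oracle_linearization_error:
  "norm (oracle_G lam mu f z u - lam *\<^sub>R (grad f z \<bullet> u) *\<^sub>R conj_pair u) \<le> lam * mu * L * norm u ^ 3"
proof -
  have "oracle_G lam mu f z u - lam *\<^sub>R (grad f z \<bullet> u) *\<^sub>R conj_pair u
      = ((f (z + mu *\<^sub>R u) - f z - grad f z \<bullet> (mu *\<^sub>R u)) * (lam / mu)) *\<^sub>R conj_pair u"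
    using mu by (simp add: oracle_G_eq field_simps flip: scaleR_diff_left)
  then have "norm (oracle_G lam mu f z u - lam *\<^sub>R (grad f z \<bullet> u) *\<^sub>R conj_pair u)
      = \<bar>f (z + mu *\<^sub>R u) - f z - grad f z \<bullet> (mu *\<^sub>R u)\<bar> * (lam / mu * norm u)"
    using lam mu by (simp add: abs_mult)
  also have "\<dots> \<le> (L * (norm (mu *\<^sub>R u))\<^sup>2) * (lam / mu * norm u)"
    using lam mu by (intro mult_right_mono first_order_error[OF diff lip L]) auto
  also have "\<dots> = lam * mu * L * norm u ^ 3"
    using mu by (simp add: power2_eq_square power3_eq_cube)
  finally show ?thesis .
qed

lemma norm_oracle_le:
  "norm (oracle_G lam mu f z u) \<le> lam * mu * L * norm u ^ 3 + lam * norm (grad f z) * (norm u)\<^sup>2"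
proof -
  have "norm (lam *\<^sub>R (grad f z \<bullet> u) *\<^sub>R conj_pair u) = lam * (\<bar>grad f z \<bullet> u\<bar> * norm u)"
    using lam by (simp add: abs_mult)
  also have "\<dots> \<le> lam * ((norm (grad f z) * norm u) * norm u)"
    using lam by (intro mult_left_mono mult_right_mono Cauchy_Schwarz_ineq2) auto
  finally have "norm (lam *\<^sub>R (grad f z \<bullet> u) *\<^sub>R conj_pair u) \<le> lam * norm (grad f z) * (norm u)\<^sup>2"
    by (simp add: power2_eq_square mult.assoc)
  then show ?thesis
    using oracle_linearization_error[of z u]
      norm_triangle_sub[of "oracle_G lam mu f z u" "lam *\<^sub>R (grad f z \<bullet> u) *\<^sub>R conj_pair u"]
    by linarith
qed

lemma integrable_oracle: "integrable (gauss lam) (oracle_G lam mu f z)"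
proof (rule Bochner_Integration.integrable_bound)
  show "integrable (gauss lam) (\<lambda>u::'a \<times> 'b. lam * mu * L * norm u ^ 3 + lam * norm (grad f z) * (norm u)\<^sup>2)"
    by (intro Bochner_Integration.integrable_add integrable_mult_right integrable_gauss_norm_power lam)
  show "AE u in gauss lam. norm (oracle_G lam mu f z u)
      \<le> norm (lam * mu * L * norm u ^ 3 + lam * norm (grad f z) * (norm u)\<^sup>2)"
    unfolding real_norm_def
    by (intro always_eventually allI order.trans[OF norm_oracle_le abs_ge_self])
  show "oracle_G lam mu f z \<in> borel_measurable (gauss lam)" by measurable
qed

lemma integrable_oracle_dist_sq: "integrable (gauss lam) (\<lambda>u. (norm (oracle_G lam mu f z u - v))\<^sup>2)"
proof (rule Bochner_Integration.integrable_bound)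
  define A where "A = lam * mu * L"
  define B where "B = lam * norm (grad f z)"
  \<comment> \<open>The factor \<open>norm u ^ 0\<close> presents the constant as a moment, so that
    one integrability rule covers all three summands.\<close>
  show "integrable (gauss lam) (\<lambda>u::'a \<times> 'b. 3 * (A\<^sup>2 * norm u ^ 6 + B\<^sup>2 * norm u ^ 4 + (norm v)\<^sup>2 * norm u ^ 0))"
    by (intro Bochner_Integration.integrable_add integrable_mult_right integrable_gauss_norm_power lam)
  show "AE u in gauss lam. norm ((norm (oracle_G lam mu f z u - v))\<^sup>2)
      \<le> norm (3 * (A\<^sup>2 * norm u ^ 6 + B\<^sup>2 * norm u ^ 4 + (norm v)\<^sup>2 * norm u ^ 0))"
  proof (intro always_eventually allI)
    fix u :: "'a \<times> 'b"
    have three: "(x + y + w)\<^sup>2 \<le> 3 * (x\<^sup>2 + y\<^sup>2 + w\<^sup>2)" for x y w :: real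
    proof -
      have "0 \<le> (x - y)\<^sup>2 + (y - w)\<^sup>2 + (w - x)\<^sup>2" by simp
      then show ?thesis by (simp add: power2_eq_square algebra_simps)
    qed
    have "norm (oracle_G lam mu f z u - v) \<le> A * norm u ^ 3 + B * (norm u)\<^sup>2 + norm v"
      using norm_triangle_ineq4[of "oracle_G lam mu f z u" v] norm_oracle_le[of z u] by (simp add: A_def B_def)
    then have "(norm (oracle_G lam mu f z u - v))\<^sup>2 \<le> (A * norm u ^ 3 + B * (norm u)\<^sup>2 + norm v)\<^sup>2"
      by (intro power_mono) auto
    also have "\<dots> \<le> 3 * ((A * norm u ^ 3)\<^sup>2 + (B * (norm u)\<^sup>2)\<^sup>2 + (norm v)\<^sup>2)" by (rule three)
    also have "\<dots> = 3 * (A\<^sup>2 * norm u ^ 6 + B\<^sup>2 * norm u ^ 4 + (norm v)\<^sup>2 * norm u ^ 0)"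
      by (simp add: power_mult_distrib flip: power_mult)
    finally show "norm ((norm (oracle_G lam mu f z u - v))\<^sup>2)
      \<le> norm (3 * (A\<^sup>2 * norm u ^ 6 + B\<^sup>2 * norm u ^ 4 + (norm v)\<^sup>2 * norm u ^ 0))"
      by simp
  qed
  show "(\<lambda>u. (norm (oracle_G lam mu f z u - v))\<^sup>2) \<in> borel_measurable (gauss lam)" by measurable
qed

text \<open>The linear part integrates exactly to the saddle operator by the covariance identity, so
  only the third moment of the linearization error remains.\<close>

lemma oracle_bias:
  "norm ((\<integral>u. oracle_G lam mu f z u \<partial>gauss lam) - saddle_op f z)
    \<le> lam * mu * L * (sqrt 3 * sqrt ((real DIM('a) + real DIM('b)) / lam) ^ 3)"
proof -
  let ?lin = "\<lambda>u. lam *\<^sub>R (grad f z \<bullet> u) *\<^sub>R conj_pair u"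
  note J = bounded_linear_conj_pair[where 'a='a and 'b='b]
  have J_eq: "?lin = (\<lambda>u. lam *\<^sub>R conj_pair ((grad f z \<bullet> u) *\<^sub>R u))"
    by (simp add: linear_cmul[OF bounded_linear.linear[OF J]])
  have int: "integrable (gauss lam) ?lin"
    unfolding J_eq
    by (intro integrable_scaleR_right integrable_bounded_linear[OF J] gauss_inner_scaleR(1)[OF lam])
  have "(\<integral>u. ?lin u \<partial>gauss lam) = lam *\<^sub>R conj_pair ((1 / lam) *\<^sub>R grad f z)"
    unfolding J_eq
    by (simp add: integral_bounded_linear[OF J gauss_inner_scaleR(1)[OF lam]] gauss_inner_scaleR(2)[OF lam])
  also have "\<dots> = saddle_op f z"
    using lam by (simp add: conj_pair_def saddle_op_eq_grad[OF diff])
  finally have "(\<integral>u. oracle_G lam mu f z u \<partial>gauss lam) - saddle_op f z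
      = (\<integral>u. oracle_G lam mu f z u - ?lin u \<partial>gauss lam)"
    using int integrable_oracle by simp
  also have "norm \<dots> \<le> (\<integral>u. norm (oracle_G lam mu f z u - ?lin u) \<partial>gauss lam)"
    by (rule integral_norm_bound)
  also have "\<dots> \<le> (\<integral>u. lam * mu * L * norm u ^ 3 \<partial>(gauss lam :: ('a \<times> 'b) measure))"
    using oracle_linearization_error int integrable_oracle
    by (intro integral_mono integrable_norm Bochner_Integration.integrable_diff integrable_mult_right
        integrable_gauss_norm_power lam)
  also have "\<dots> = lam * mu * L * (\<integral>u. norm u ^ 3 \<partial>(gauss lam :: ('a \<times> 'b) measure))" by simp
  also have "\<dots> \<le> lam * mu * L * (sqrt 3 * sqrt ((real DIM('a) + real DIM('b)) / lam) ^ 3)"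
    using gauss_norm_moments(3)[OF lam, where 'a = "'a \<times> 'b"] lam mu L
    by (intro mult_left_mono) auto
  finally show ?thesis .
qed

text \<open>
  The variance hypothesis is centred at the operator of the smoothed function; centring at the mean
  instead avoids proving that the two coincide.
\<close>

lemma oracle_variance_le:
  "(\<integral>u. (norm (oracle_G lam mu f z u - (\<integral>u. oracle_G lam mu f z u \<partial>gauss lam)))\<^sup>2 \<partial>gauss lam)
    \<le> (\<integral>u. (norm (oracle_G lam mu f z u - v))\<^sup>2 \<partial>gauss lam)"
proof -
  interpret prob_space "gauss lam :: ('a \<times> 'b) measure" by (rule prob_space_gauss[OF lam])
  have prob_UNIV: "prob UNIV = 1" using prob_space by simp
  define m where "m = (\<integral>u. oracle_G lam mu f z u \<partial>gauss lam)"
  \<comment> \<open>Bias-variance decomposition: the cross term integrates to zero because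
    \<open>m\<close> is the mean.\<close>
  have eq: "(norm (oracle_G lam mu f z u - v))\<^sup>2
      = (norm (oracle_G lam mu f z u - m))\<^sup>2 + 2 * ((oracle_G lam mu f z u - m) \<bullet> (m - v)) + (norm (m - v))\<^sup>2" for u
    unfolding power2_norm_eq_inner by (simp add: algebra_simps inner_commute)
  have int: "integrable (gauss lam) (\<lambda>u. oracle_G lam mu f z u - m)"
    by (intro Bochner_Integration.integrable_diff integrable_oracle) simp
  have "(\<integral>u. (oracle_G lam mu f z u - m) \<bullet> (m - v) \<partial>gauss lam) = (\<integral>u. oracle_G lam mu f z u - m \<partial>gauss lam) \<bullet> (m - v)"
    by (rule integral_inner_left) (rule int)
  also have "\<dots> = 0" using integrable_oracle by (simp add: m_def prob_UNIV)
  finally have "(\<integral>u. (norm (oracle_G lam mu f z u - v))\<^sup>2 \<partial>gauss lam)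
      = (\<integral>u. (norm (oracle_G lam mu f z u - m))\<^sup>2 \<partial>gauss lam) + (norm (m - v))\<^sup>2"
    unfolding eq using integrable_oracle_dist_sq int by (simp add: prob_UNIV)
  then show ?thesis by (simp add: m_def)
qed

end

section \<open>Independent batches\<close>

lemma (in prob_space) indep_vars_imp_indep_var:
  assumes "indep_vars M' X I" "i \<in> I" "j \<in> I" "i \<noteq> j"
  shows "indep_var (M' i) (X i) (M' j) (X j)"
proof -
  have "indep_var (PiM {i} M') (\<lambda>\<omega>. restrict (\<lambda>i. X i \<omega>) {i}) (PiM {j} M') (\<lambda>\<omega>. restrict (\<lambda>i. X i \<omega>) {j})"
    using assms by (intro indep_var_restrict[OF assms(1)]) auto
  then have "indep_var (M' i) ((\<lambda>x. x i) \<circ> (\<lambda>\<omega>. restrict (\<lambda>i. X i \<omega>) {i}))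
      (M' j) ((\<lambda>x. x j) \<circ> (\<lambda>\<omega>. restrict (\<lambda>i. X i \<omega>) {j}))"
    by (rule indep_var_compose) (auto intro!: measurable_component_singleton)
  then show ?thesis by (simp add: comp_def)
qed

text \<open>Pairwise independence and zero means remove all cross terms in the expansion of the
  square.\<close>

lemma (in prob_space) expectation_norm_sum_sq:
  fixes W :: "'i \<Rightarrow> 'a \<Rightarrow> 'e::euclidean_space"
  assumes indep: "\<And>i j. i \<in> I \<Longrightarrow> j \<in> I \<Longrightarrow> i \<noteq> j \<Longrightarrow> indep_var borel (W i) borel (W j)"
    and int: "\<And>i. i \<in> I \<Longrightarrow> integrable M (W i)"
    and mean: "\<And>i. i \<in> I \<Longrightarrow> expectation (W i) = 0"
    and sq: "\<And>i. i \<in> I \<Longrightarrow> integrable M (\<lambda>\<omega>. (norm (W i \<omega>))\<^sup>2)"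
  shows "integrable M (\<lambda>\<omega>. (norm (\<Sum>i\<in>I. W i \<omega>))\<^sup>2)"
    and "expectation (\<lambda>\<omega>. (norm (\<Sum>i\<in>I. W i \<omega>))\<^sup>2) = (\<Sum>i\<in>I. expectation (\<lambda>\<omega>. (norm (W i \<omega>))\<^sup>2))"
proof -
  have cross: "integrable M (\<lambda>\<omega>. W i \<omega> \<bullet> W j \<omega>) \<and>
      expectation (\<lambda>\<omega>. W i \<omega> \<bullet> W j \<omega>) = (if i = j then expectation (\<lambda>\<omega>. (norm (W i \<omega>))\<^sup>2) else 0)"
    if ij: "i \<in> I" "j \<in> I" for i j
  proof (cases "i = j")
    case True
    then show ?thesis using sq[OF ij(1)] by (simp add: power2_norm_eq_inner)
  next
    case False
    \<comment> \<open>The product rule for expectations concerns scalar variables, hence the inner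
      product is expanded in coordinates.\<close>
    have ind: "indep_var borel (\<lambda>\<omega>. W i \<omega> \<bullet> b) borel (\<lambda>\<omega>. W j \<omega> \<bullet> b)" for b
      using indep_var_compose[OF indep[OF ij False], of "\<lambda>x. x \<bullet> b" borel "\<lambda>x. x \<bullet> b" borel]
      by (simp add: comp_def)
    have ints: "integrable M (\<lambda>\<omega>. W i \<omega> \<bullet> b)" "integrable M (\<lambda>\<omega>. W j \<omega> \<bullet> b)" for b
      using int ij by auto
    have "expectation (\<lambda>\<omega>. W i \<omega> \<bullet> b) = 0" for b
      using integral_inner_left[of b M "W i"] int[OF ij(1)] mean[OF ij(1)] by simp
    then have E: "expectation (\<lambda>\<omega>. (W i \<omega> \<bullet> b) * (W j \<omega> \<bullet> b)) = 0" for b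
      using indep_var_lebesgue_integral[OF ind ints] by simp
    note I = indep_var_integrable[OF ind ints]
    show ?thesis using False I E
      unfolding euclidean_inner[of "W i _" "W j _"] by simp
  qed
  have eq: "(norm (\<Sum>i\<in>I. W i \<omega>))\<^sup>2 = (\<Sum>i\<in>I. \<Sum>j\<in>I. W i \<omega> \<bullet> W j \<omega>)" for \<omega>
    unfolding power2_norm_eq_inner by (simp add: inner_sum_left inner_sum_right) (rule sum.swap)
  show "integrable M (\<lambda>\<omega>. (norm (\<Sum>i\<in>I. W i \<omega>))\<^sup>2)"
    unfolding eq using cross by (intro Bochner_Integration.integrable_sum) blast
  have "expectation (\<lambda>\<omega>. (norm (\<Sum>i\<in>I. W i \<omega>))\<^sup>2) = (\<Sum>i\<in>I. \<Sum>j\<in>I. expectation (\<lambda>\<omega>. W i \<omega> \<bullet> W j \<omega>))"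
    unfolding eq using cross by (simp add: Bochner_Integration.integral_sum Bochner_Integration.integrable_sum)
  also have "\<dots> = (\<Sum>i\<in>I. \<Sum>j\<in>I. if i = j then expectation (\<lambda>\<omega>. (norm (W i \<omega>))\<^sup>2) else 0)"
    using cross by (intro sum.cong) auto
  \<comment> \<open>For infinite \<open>I\<close> both sums are 0 by convention.\<close>
  finally show "expectation (\<lambda>\<omega>. (norm (\<Sum>i\<in>I. W i \<omega>))\<^sup>2) = (\<Sum>i\<in>I. expectation (\<lambda>\<omega>. (norm (W i \<omega>))\<^sup>2))"
    by (cases "finite I") (simp_all add: sum.delta)
qed

text \<open>A freezing argument in place of conditional expectation: independence makes the joint
  law a product, so Fubini allows \<open>X\<close> to be held fixed. Nonnegative integrals free it
  from integrability side conditions.\<close>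

lemma (in prob_space) nn_integral_indep_le:
  assumes "indep_var S X T Y" and [measurable]: "\<phi> \<in> borel_measurable (S \<Otimes>\<^sub>M T)"
    and bound: "\<And>x. x \<in> space S \<Longrightarrow> (\<integral>\<^sup>+\<omega>. \<phi> (x, Y \<omega>) \<partial>M) \<le> C"
  shows "(\<integral>\<^sup>+\<omega>. \<phi> (X \<omega>, Y \<omega>) \<partial>M) \<le> C"
proof -
  have X [measurable]: "random_variable S X" and Y [measurable]: "random_variable T Y"
    and joint: "distr M S X \<Otimes>\<^sub>M distr M T Y = distr M (S \<Otimes>\<^sub>M T) (\<lambda>x. (X x, Y x))"
    using assms(1) unfolding indep_var_distribution_eq by auto
  interpret DX: prob_space "distr M S X" by (rule prob_space_distr) (rule X)
  interpret DY: prob_space "distr M T Y" by (rule prob_space_distr) (rule Y)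
  have "(\<integral>\<^sup>+\<omega>. \<phi> (X \<omega>, Y \<omega>) \<partial>M) = (\<integral>\<^sup>+p. \<phi> p \<partial>(distr M S X \<Otimes>\<^sub>M distr M T Y))"
    unfolding joint by (subst nn_integral_distr) auto
  also have "\<dots> = (\<integral>\<^sup>+x. \<integral>\<^sup>+y. \<phi> (x, y) \<partial>distr M T Y \<partial>distr M S X)"
    by (rule DY.nn_integral_fst[symmetric]) simp
  also have "\<dots> \<le> (\<integral>\<^sup>+x. C \<partial>distr M S X)"
    using bound by (intro nn_integral_mono) (simp add: nn_integral_distr)
  also have "\<dots> = C" using DX.emeasure_space_1 by simp
  finally show ?thesis .
qed

context smooth_oracle
begin

lemma borel_measurable_oracle_mean [measurable]:
  "(\<lambda>z. \<integral>u. oracle_G lam mu f z u \<partial>gauss lam) \<in> borel_measurable borel"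
proof -
  interpret prob_space "gauss lam :: ('a \<times> 'b) measure" by (rule prob_space_gauss[OF lam])
  show ?thesis by measurable
qed

lemma borel_measurable_batch_G:
  assumes [measurable]: "\<And>i. i \<in> {1..t} \<Longrightarrow> g i \<in> borel_measurable N" "k \<in> borel_measurable N"
  shows "(\<lambda>x. batch_G lam mu f t (\<lambda>i. g i x) (k x)) \<in> borel_measurable N"
proof -
  show ?thesis unfolding batch_G_def by measurable
qed

text \<open>At a fixed point the deviations are centred and pairwise independent, so their mean
  squares add and averaging gains a factor \<open>1 / t\<close>. The centre \<open>v\<close> of the
  variance bound may be arbitrary because the mean minimises the mean squared distance.\<close>

lemma batch_mean_sq_error:
  assumes M: "prob_space M"
    and indep: "\<And>i j. i \<in> {1..t} \<Longrightarrow> j \<in> {1..t} \<Longrightarrow> i \<noteq> j \<Longrightarrow> prob_space.indep_var M borel (V i) borel (V j)"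
    and V: "\<And>i. i \<in> {1..t} \<Longrightarrow> V i \<in> borel_measurable M"
    and law: "\<And>i. i \<in> {1..t} \<Longrightarrow> distr M borel (V i) = gauss lam"
    and var: "(\<integral>u. (norm (oracle_G lam mu f z u - v))\<^sup>2 \<partial>gauss lam) \<le> s2"
    and t: "t \<ge> 1"
  shows "(\<integral>\<^sup>+\<omega>. ennreal ((norm (batch_G lam mu f t (\<lambda>i. V i \<omega>) z
      - (\<integral>u. oracle_G lam mu f z u \<partial>gauss lam)))\<^sup>2) \<partial>M) \<le> ennreal (s2 / t)"
proof -
  interpret prob_space M by (rule M)
  define m where "m = (\<integral>u. oracle_G lam mu f z u \<partial>gauss lam)"
  define W where "W = (\<lambda>i \<omega>. oracle_G lam mu f z (V i \<omega>) - m)"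
  have dist: "integrable M (\<lambda>\<omega>. oracle_G lam mu f z (V i \<omega>))"
      "expectation (\<lambda>\<omega>. oracle_G lam mu f z (V i \<omega>)) = m"
      "integrable M (\<lambda>\<omega>. (norm (oracle_G lam mu f z (V i \<omega>) - m))\<^sup>2)"
      "expectation (\<lambda>\<omega>. (norm (oracle_G lam mu f z (V i \<omega>) - m))\<^sup>2)
        = (\<integral>u. (norm (oracle_G lam mu f z u - m))\<^sup>2 \<partial>gauss lam)" if i: "i \<in> {1..t}" for i
    using integrable_oracle[of z] integrable_oracle_dist_sq[of z m]
    unfolding m_def law[OF i, symmetric]
    by (simp_all add: integrable_distr_eq integral_distr V[OF i])
  have int: "integrable M (W i)" and mean: "expectation (W i) = 0"
    and sq: "integrable M (\<lambda>\<omega>. (norm (W i \<omega>))\<^sup>2)"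
    and sq_le: "expectation (\<lambda>\<omega>. (norm (W i \<omega>))\<^sup>2) \<le> s2" if i: "i \<in> {1..t}" for i
  proof -
    show "integrable M (W i)" "expectation (W i) = 0" "integrable M (\<lambda>\<omega>. (norm (W i \<omega>))\<^sup>2)"
      using dist[OF i] by (simp_all add: W_def prob_space)
    show "expectation (\<lambda>\<omega>. (norm (W i \<omega>))\<^sup>2) \<le> s2"
      using dist(4)[OF i] order.trans[OF oracle_variance_le var]
      by (simp add: W_def m_def)
  qed
  have ind: "indep_var borel (W i) borel (W j)" if "i \<in> {1..t}" "j \<in> {1..t}" "i \<noteq> j" for i j
    using indep_var_compose[OF indep[OF that], of "\<lambda>u. oracle_G lam mu f z u - m" borel "\<lambda>u. oracle_G lam mu f z u - m" borel]
    by (simp add: W_def comp_def)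
  have sum_eq: "batch_G lam mu f t (\<lambda>i. V i \<omega>) z - m = (1 / real t) *\<^sub>R (\<Sum>i=1..t. W i \<omega>)" for \<omega>
    using t by (simp add: batch_G_def W_def sum_subtractf scaleR_diff_right sum_constant_scaleR)
  have eq: "(norm (batch_G lam mu f t (\<lambda>i. V i \<omega>) z - m))\<^sup>2 = (norm (\<Sum>i=1..t. W i \<omega>))\<^sup>2 / (real t)\<^sup>2" for \<omega>
    unfolding sum_eq by (simp add: power_divide)
  have "(\<integral>\<^sup>+\<omega>. ennreal ((norm (batch_G lam mu f t (\<lambda>i. V i \<omega>) z - m))\<^sup>2) \<partial>M)
      = ennreal (expectation (\<lambda>\<omega>. (norm (\<Sum>i=1..t. W i \<omega>))\<^sup>2 / (real t)\<^sup>2))"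
    unfolding eq
    by (intro nn_integral_eq_integral integrable_divide expectation_norm_sum_sq(1) ind int mean sq) auto
  also have "expectation (\<lambda>\<omega>. (norm (\<Sum>i=1..t. W i \<omega>))\<^sup>2 / (real t)\<^sup>2)
      = (\<Sum>i=1..t. expectation (\<lambda>\<omega>. (norm (W i \<omega>))\<^sup>2)) / (real t)\<^sup>2"
    using expectation_norm_sum_sq(2)[of "{1..t}" W, OF ind int mean sq] by simp
  also have "\<dots> \<le> (real t * s2) / (real t)\<^sup>2"
    using sum_bounded_above[of "{1..t}" "\<lambda>i. expectation (\<lambda>\<omega>. (norm (W i \<omega>))\<^sup>2)" s2] sq_le
    by (intro divide_right_mono) auto
  also have "\<dots> = s2 / t" using t by (simp add: power2_eq_square)
  finally show ?thesis by (simp add: m_def ennreal_leI)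
qed

text \<open>The evaluation point may be random as long as it is a function of the samples in
  \<open>A\<close> and the batch lies outside \<open>A\<close>: freezing the former reduces to a
  fixed point. This encodes adaptedness without a filtration.\<close>

lemma adapted_batch_mean_sq_error:
  assumes M: "prob_space M" and X: "prob_space.indep_vars M (\<lambda>_. borel) X I"
    and law: "\<And>i. i \<in> I \<Longrightarrow> distr M borel (X i) = gauss lam"
    and A: "A \<subseteq> I" "x \<in> borel_measurable (PiM A (\<lambda>_. borel))"
    and idx: "inj_on idx {1..t}" "\<And>i. i \<in> {1..t} \<Longrightarrow> idx i \<in> I - A"
    and var: "\<And>z. (\<integral>u. (norm (oracle_G lam mu f z u - v z))\<^sup>2 \<partial>gauss lam) \<le> s2"
    and t: "t \<ge> 1"
  shows "(\<integral>\<^sup>+\<omega>. ennreal ((norm (batch_G lam mu f t (\<lambda>i. X (idx i) \<omega>) (x (\<lambda>i\<in>A. X i \<omega>))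
      - (\<integral>u. oracle_G lam mu f (x (\<lambda>i\<in>A. X i \<omega>)) u \<partial>gauss lam)))\<^sup>2) \<partial>M) \<le> ennreal (s2 / t)"
proof -
  interpret prob_space M by (rule M)
  define B where "B = idx ` {1..t}"
  have B: "A \<inter> B = {}" "B \<subseteq> I" using idx(2) by (auto simp: B_def)
  have idx_B: "idx i \<in> B" if "i \<in> {1..t}" for i using that by (simp add: B_def)
  have batch_B: "batch_G lam mu f t (\<lambda>i. (\<lambda>j\<in>B. X j \<omega>) (idx i)) w = batch_G lam mu f t (\<lambda>i. X (idx i) \<omega>) w" for w \<omega>
    unfolding batch_G_def using idx_B by (intro arg_cong2[where f = scaleR] sum.cong refl) simp
  define \<phi> where "\<phi> = (\<lambda>(a, b). ennreal ((norm (batch_G lam mu f t (\<lambda>i. b (idx i)) (x a)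
      - (\<integral>u. oracle_G lam mu f (x a) u \<partial>gauss lam)))\<^sup>2))"
  have rv: "X i \<in> borel_measurable M" if "i \<in> I" for i
    using X that by (auto simp: indep_vars_def)
  note A(2) [measurable]
  have [measurable]: "(\<lambda>(a, b). batch_G lam mu f t (\<lambda>i. b (idx i)) (x a))
      \<in> borel_measurable (PiM A (\<lambda>_. borel) \<Otimes>\<^sub>M PiM B (\<lambda>_. borel))"
    unfolding case_prod_beta
  proof (rule borel_measurable_batch_G)
    fix i assume "i \<in> {1..t}"
    note idx_B[OF this, measurable]
    show "(\<lambda>p. snd p (idx i)) \<in> borel_measurable (PiM A (\<lambda>_. borel) \<Otimes>\<^sub>M PiM B (\<lambda>_. borel))"
      by measurable
  qed measurable
  have meas: "\<phi> \<in> borel_measurable (PiM A (\<lambda>_. borel) \<Otimes>\<^sub>M PiM B (\<lambda>_. borel))"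
    unfolding \<phi>_def by measurable
  have "(\<integral>\<^sup>+\<omega>. \<phi> (\<lambda>i\<in>A. X i \<omega>, \<lambda>i\<in>B. X i \<omega>) \<partial>M) \<le> ennreal (s2 / t)"
  proof (rule nn_integral_indep_le[OF indep_var_restrict[OF X B(1) A(1) B(2)] meas])
    fix a
    have "(\<integral>\<^sup>+\<omega>. \<phi> (a, \<lambda>i\<in>B. X i \<omega>) \<partial>M) = (\<integral>\<^sup>+\<omega>. ennreal ((norm (batch_G lam mu f t (\<lambda>i. X (idx i) \<omega>) (x a)
      - (\<integral>u. oracle_G lam mu f (x a) u \<partial>gauss lam)))\<^sup>2) \<partial>M)"
      by (simp only: \<phi>_def batch_B prod.case)
    also have "\<dots> \<le> ennreal (s2 / t)"
    proof (rule batch_mean_sq_error[OF M _ _ _ var t])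
      fix i j assume ij: "i \<in> {1..t}" "j \<in> {1..t}" "i \<noteq> j"
      then have "idx i \<noteq> idx j" using idx(1) by (meson inj_onD)
      then show "indep_var borel (X (idx i)) borel (X (idx j))"
        using indep_vars_imp_indep_var[OF X, of "idx i" "idx j"] idx(2) ij(1,2) by blast
    qed (use idx(2) rv law in blast)+
    finally show "(\<integral>\<^sup>+\<omega>. \<phi> (a, \<lambda>i\<in>B. X i \<omega>) \<partial>M) \<le> ennreal (s2 / t)" .
  qed
  then show ?thesis by (simp only: \<phi>_def batch_B prod.case)
qed

end

section \<open>The iterates as functions of the samples\<close>

text \<open>
  The iterates as deterministic functions of the sample sequence: \<open>Inl (k, i)\<close> indexes the samples
  of the extrapolation step, \<open>Inr (k, i)\<close> those of the update step, as in \<^const>\<open>gauss_samples\<close>.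
\<close>

primrec eg_iter :: "('v \<Rightarrow> 'v) \<Rightarrow> ((nat \<Rightarrow> 'v) \<Rightarrow> 'v \<Rightarrow> 'v) \<Rightarrow> real \<Rightarrow> 'v::real_vector
    \<Rightarrow> nat \<Rightarrow> (nat \<times> nat + nat \<times> nat \<Rightarrow> 'v) \<Rightarrow> 'v" where
  "eg_iter P G h x0 0 s = x0"
| "eg_iter P G h x0 (Suc k) s = P (eg_iter P G h x0 k s - h *\<^sub>R G (\<lambda>i. s (Inr (k, i)))
     (P (eg_iter P G h x0 k s - h *\<^sub>R G (\<lambda>i. s (Inl (k, i))) (eg_iter P G h x0 k s))))"

definition eg_half :: "('v \<Rightarrow> 'v) \<Rightarrow> ((nat \<Rightarrow> 'v) \<Rightarrow> 'v \<Rightarrow> 'v) \<Rightarrow> real \<Rightarrow> 'v::real_vector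
    \<Rightarrow> nat \<Rightarrow> (nat \<times> nat + nat \<times> nat \<Rightarrow> 'v) \<Rightarrow> 'v" where
  "eg_half P G h x0 k s =
     P (eg_iter P G h x0 k s - h *\<^sub>R G (\<lambda>i. s (Inl (k, i))) (eg_iter P G h x0 k s))"

lemma batch_G_cong:
  "(\<And>i. i \<in> {1..t} \<Longrightarrow> u i = u' i) \<Longrightarrow> batch_G lam mu f t u z = batch_G lam mu f t u' z"
  unfolding batch_G_def by (intro arg_cong2[where f = scaleR] sum.cong) auto

text \<open>Agreement of \<open>s\<close> is required only for iterations before \<open>k\<close>,
  so \<open>s\<close> may be the sample family restricted to the past; this makes the current
  batches independent of the iterate.\<close>

lemma vr_zo_eg_eq_eg_iter:
  assumes "vr_zo_eg lam mu f Z (\<lambda>_. h) (\<lambda>_. h) (\<lambda>_. t) N z0 uh u z zh"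
    and "k \<le> Suc N"
    and "\<And>j i. j < k \<Longrightarrow> i \<in> {1..t} \<Longrightarrow> s (Inl (j, i)) = uh j i \<and> s (Inr (j, i)) = u j i"
  shows "z k = eg_iter (Proj lam Z) (batch_G lam mu f t) h z0 k s"
  using assms(2,3)
proof (induction k)
  case 0
  then show ?case using assms(1) by (simp add: vr_zo_eg_def)
next
  case (Suc k)
  then have IH: "z k = eg_iter (Proj lam Z) (batch_G lam mu f t) h z0 k s" by simp
  have b: "batch_G lam mu f t (\<lambda>i. s (Inl (k, i))) w = batch_G lam mu f t (uh k) w"
    "batch_G lam mu f t (\<lambda>i. s (Inr (k, i))) w = batch_G lam mu f t (u k) w" for w
    using Suc.prems(2)[of k] by (auto intro!: batch_G_cong)
  show ?case using assms(1) Suc.prems(1) by (simp add: vr_zo_eg_def b flip: IH)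
qed

text \<open>The extrapolated point also sees the \<open>Inl\<close> batch of iteration
  \<open>k\<close> but not its \<open>Inr\<close> batch, which therefore remains fresh for the
  update.\<close>

lemma vr_zo_eg_eq_eg_half:
  assumes "vr_zo_eg lam mu f Z (\<lambda>_. h) (\<lambda>_. h) (\<lambda>_. t) N z0 uh u z zh"
    and "k \<le> N"
    and "\<And>j i. j < k \<Longrightarrow> i \<in> {1..t} \<Longrightarrow> s (Inl (j, i)) = uh j i \<and> s (Inr (j, i)) = u j i"
    and "\<And>i. i \<in> {1..t} \<Longrightarrow> s (Inl (k, i)) = uh k i"
  shows "zh k = eg_half (Proj lam Z) (batch_G lam mu f t) h z0 k s"
proof -
  have b: "batch_G lam mu f t (\<lambda>i. s (Inl (k, i))) w = batch_G lam mu f t (uh k) w" for w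
    using assms(4) by (auto intro!: batch_G_cong)
  have "z k = eg_iter (Proj lam Z) (batch_G lam mu f t) h z0 k s"
    using vr_zo_eg_eq_eg_iter[OF assms(1) _ assms(3)] assms(2) by simp
  then show ?thesis using assms(1,2) by (simp add: vr_zo_eg_def eg_half_def b)
qed

context smooth_oracle
begin

lemma borel_measurable_eg_iter:
  assumes P [measurable]: "P \<in> borel_measurable borel"
    and past: "\<And>j i. j < k \<Longrightarrow> i \<in> {1..t} \<Longrightarrow> Inl (j, i) \<in> A \<and> Inr (j, i) \<in> A"
  shows "eg_iter P (batch_G lam mu f t) h z0 k \<in> borel_measurable (PiM A (\<lambda>_. borel))"
  using past
proof (induction k)
  case 0
  then show ?case by (simp add: fun_eq_iff[symmetric] cong: measurable_cong)
next
  case (Suc k)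
  then have IH [measurable]: "eg_iter P (batch_G lam mu f t) h z0 k \<in> borel_measurable (PiM A (\<lambda>_. borel))"
    by simp
  have [measurable]: "(\<lambda>s. s (Inl (k, i))) \<in> borel_measurable (PiM A (\<lambda>_. borel))"
    "(\<lambda>s. s (Inr (k, i))) \<in> borel_measurable (PiM A (\<lambda>_. borel))" if "i \<in> {1..t}" for i
    using Suc.prems[of k i] that by (auto intro: measurable_component_singleton)
  note borel_measurable_batch_G[measurable]
  show ?case unfolding eg_iter.simps by measurable
qed

lemma borel_measurable_eg_half:
  assumes P [measurable]: "P \<in> borel_measurable borel"
    and past: "\<And>j i. j < k \<Longrightarrow> i \<in> {1..t} \<Longrightarrow> Inl (j, i) \<in> A \<and> Inr (j, i) \<in> A"
    and now: "\<And>i. i \<in> {1..t} \<Longrightarrow> Inl (k, i) \<in> A"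
  shows "eg_half P (batch_G lam mu f t) h z0 k \<in> borel_measurable (PiM A (\<lambda>_. borel))"
proof -
  have [measurable]: "eg_iter P (batch_G lam mu f t) h z0 k \<in> borel_measurable (PiM A (\<lambda>_. borel))"
    using P past by (rule borel_measurable_eg_iter)
  have [measurable]: "(\<lambda>s. s (Inl (k, i))) \<in> borel_measurable (PiM A (\<lambda>_. borel))" if "i \<in> {1..t}" for i
    using now that by (auto intro: measurable_component_singleton)
  note borel_measurable_batch_G[measurable]
  show ?thesis unfolding eg_half_def by measurable
qed

end

section \<open>The complexity bound\<close>

text \<open>The threshold is the positive root of 4 a mu^2 + 4 b mu = \<epsilon>^2; dropping the
  quadratic term leaves the claim.\<close>

lemma smoothing_parameter_bound:
  fixes a b mu \<epsilon> :: real
  assumes "a > 0" "b \<ge> 0" "mu \<ge> 0" "mu \<le> (- b + sqrt (b\<^sup>2 + a * \<epsilon>\<^sup>2)) / (2 * a)"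
  shows "4 * b * mu \<le> \<epsilon>\<^sup>2"
proof -
  have "2 * a * mu + b \<le> sqrt (b\<^sup>2 + a * \<epsilon>\<^sup>2)"
    using assms by (simp add: field_simps)
  then have "(2 * a * mu + b)\<^sup>2 \<le> (sqrt (b\<^sup>2 + a * \<epsilon>\<^sup>2))\<^sup>2"
    using assms by (intro power_mono) auto
  also have "\<dots> = b\<^sup>2 + a * \<epsilon>\<^sup>2" using assms(1) by simp
  finally have "a * (4 * (a * mu\<^sup>2) + 4 * b * mu) \<le> a * \<epsilon>\<^sup>2"
    by (simp add: power2_eq_square algebra_simps)
  then have "4 * (a * mu\<^sup>2) + 4 * b * mu \<le> \<epsilon>\<^sup>2"
    using assms(1) mult_le_cancel_left_pos by blast
  moreover have "0 \<le> a * mu\<^sup>2" using assms(1) by simp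
  ultimately show ?thesis by linarith
qed

text \<open>
  The hypothesis \<open>h * \<epsilon> \<le> \<Delta>\<close> turns the bound on \<open>\<Delta> * \<beta>\<close> into one on \<open>h * \<beta>\<close>, which controls the
  quadratic bias term; otherwise the residuals are at most \<open>\<epsilon>\<close> trivially.
\<close>

lemma extragradient_complexity_arith:
  fixes L h D \<epsilon> \<Delta> \<beta> S R n E :: real
  assumes L: "L > 0" "h > 0" "L * h \<le> 1 / 2" and D: "D > 0" "D \<le> L * h\<^sup>2" and eps: "\<epsilon> > 0"
    and nonneg: "\<beta> \<ge> 0" "S \<ge> 0" "\<Delta> \<ge> 0" "n > 0"
    and sum: "h\<^sup>2 / 3 * E \<le> R + n * (14 * h\<^sup>2 * (S\<^sup>2 + \<beta>\<^sup>2) + 2 * \<Delta> * h * (\<beta> + S))"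
    and diam: "h * \<epsilon> \<le> \<Delta>"
    and bias: "\<Delta> * \<beta> \<le> 0.11 * (D * \<epsilon>\<^sup>2)" and S1: "\<Delta> * S \<le> 0.0885 * (D * \<epsilon>\<^sup>2)"
    and S2: "128 * S\<^sup>2 \<le> L * (D * \<epsilon>\<^sup>2)" and R: "32 * L * R \<le> n * (D * \<epsilon>\<^sup>2)"
  shows "E \<le> n * \<epsilon>\<^sup>2"
proof -
  define Q where "Q = D * \<epsilon>\<^sup>2"
  have Q: "Q \<ge> 0" using D by (simp add: Q_def)
  have Lh2: "(L * h)\<^sup>2 \<le> 1 / 4"
    using power_mono[OF L(3), of 2] L by (simp add: power_divide)
  have a: "L * h\<^sup>2 * S\<^sup>2 \<le> Q / 512"
  proof -
    have "L * h\<^sup>2 * S\<^sup>2 \<le> L * h\<^sup>2 * (L * Q / 128)"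
      using S2 L by (intro mult_left_mono) (auto simp: Q_def)
    also have "\<dots> = (L * h)\<^sup>2 * (Q / 128)" by (simp add: power2_eq_square)
    also have "\<dots> \<le> 1 / 4 * (Q / 128)" using Lh2 Q by (intro mult_right_mono) auto
    finally show ?thesis by simp
  qed
  \<comment> \<open>The constant is 0.11 squared times the 1/4 from \<open>Lh2\<close>.\<close>
  have b: "L * h\<^sup>2 * \<beta>\<^sup>2 \<le> 0.003025 * Q"
  proof -
    have "(h * \<epsilon>) * \<beta> \<le> \<Delta> * \<beta>" using diam nonneg by (intro mult_right_mono) auto
    then have "\<epsilon> * (h * \<beta>) \<le> \<epsilon> * (0.11 * D * \<epsilon>)"
      using bias by (simp add: power2_eq_square algebra_simps)
    then have "h * \<beta> \<le> 0.11 * D * \<epsilon>" using eps by simp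
    then have "(h * \<beta>)\<^sup>2 \<le> (0.11 * D * \<epsilon>)\<^sup>2" using L nonneg by (intro power_mono) auto
    also have "\<dots> = 0.0121 * D * Q" by (simp add: Q_def power2_eq_square)
    also have "\<dots> \<le> 0.0121 * (L * h\<^sup>2) * Q" using D Q by (intro mult_right_mono mult_left_mono) auto
    finally have "L * (h * \<beta>)\<^sup>2 \<le> L * (0.0121 * (L * h\<^sup>2) * Q)" using L by (intro mult_left_mono) auto
    also have "\<dots> = (L * h)\<^sup>2 * (0.0121 * Q)" by (simp add: power2_eq_square)
    also have "\<dots> \<le> 1 / 4 * (0.0121 * Q)" using Lh2 Q by (intro mult_right_mono) auto
    finally show ?thesis by (simp add: power_mult_distrib mult.assoc)
  qed
  \<comment> \<open>The constant is 0.11 + 0.0885, as \<open>L * h\<close> at most 1/2 cancels the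
    factor 2.\<close>
  have c: "2 * \<Delta> * (L * h) * (\<beta> + S) \<le> 0.1985 * Q"
  proof -
    have "(L * h) * (2 * \<Delta> * (\<beta> + S)) \<le> 1 / 2 * (2 * \<Delta> * (\<beta> + S))"
      using L(3) nonneg by (intro mult_right_mono) auto
    then show ?thesis using bias S1 by (simp add: algebra_simps Q_def)
  qed
  have "L * h\<^sup>2 / 3 * E \<le> L * (R + n * (14 * h\<^sup>2 * (S\<^sup>2 + \<beta>\<^sup>2) + 2 * \<Delta> * h * (\<beta> + S)))"
    using mult_left_mono[OF sum, of L] L by simp
  also have "\<dots> = L * R + n * (14 * (L * h\<^sup>2 * S\<^sup>2) + 14 * (L * h\<^sup>2 * \<beta>\<^sup>2) + 2 * \<Delta> * (L * h) * (\<beta> + S))"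
    by (simp add: algebra_simps)
  also have "\<dots> \<le> n * Q / 32 + n * (14 * (Q / 512) + 14 * (0.003025 * Q) + 0.1985 * Q)"
    using a b c R nonneg(4) by (intro add_mono mult_left_mono) (auto simp: Q_def)
  \<comment> \<open>The coefficients 1/32 + 14/512 + 14 * 0.003025 + 0.1985 add up to about
    0.2994.\<close>
  also have "\<dots> \<le> 1 / 3 * (n * Q)" using Q nonneg(4) by (simp add: field_simps)
  also have "\<dots> \<le> 1 / 3 * (n * (L * h\<^sup>2 * \<epsilon>\<^sup>2))"
    using D nonneg(4) unfolding Q_def by (intro mult_left_mono mult_right_mono) auto
  finally have "L * h\<^sup>2 * E \<le> L * h\<^sup>2 * (n * \<epsilon>\<^sup>2)" by (simp add: algebra_simps)
  then show ?thesis using L by simp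
qed

lemma integral_le_of_nn_integral_le:
  fixes g :: "'a \<Rightarrow> real"
  assumes "g \<in> borel_measurable M" "\<And>x. g x \<ge> 0" "(\<integral>\<^sup>+x. ennreal (g x) \<partial>M) \<le> ennreal c" "c \<ge> 0"
  shows "integrable M g" "(\<integral>x. g x \<partial>M) \<le> c"
proof -
  show int: "integrable M g"
    using assms(1,2) le_less_trans[OF assms(3) ennreal_less_top] by (intro integrableI_bounded) auto
  show "(\<integral>x. g x \<partial>M) \<le> c"
    using assms nn_integral_eq_integral[OF int] by simp
qed

text \<open>Jensen's inequality for the square, from nonnegativity of the variance.\<close>

lemma (in prob_space) expectation_le_sqrt_expectation_sq:
  fixes X :: "'a \<Rightarrow> real"
  assumes "X \<in> borel_measurable M" "integrable M (\<lambda>\<omega>. (X \<omega>)\<^sup>2)" "expectation (\<lambda>\<omega>. (X \<omega>)\<^sup>2) \<le> c"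
  shows "integrable M X" "expectation X \<le> sqrt c"
proof -
  show int: "integrable M X"
    using square_integrable_imp_integrable[OF assms(1,2)] by simp
  have "(expectation X)\<^sup>2 \<le> expectation (\<lambda>\<omega>. (X \<omega>)\<^sup>2)"
    using variance_eq[OF int assms(2)] variance_positive[of X] by simp
  then have "(expectation X)\<^sup>2 \<le> c" using assms(3) by simp
  then show "expectation X \<le> sqrt c" by (rule real_le_rsqrt)
qed

lemma norm_diff_le_bdiam:
  fixes Z :: "'a::euclidean_space set"
  assumes "lam > 0" "bounded Z" "v \<in> Z" "w \<in> Z"
  shows "norm (v - w) \<le> bdiam lam Z / sqrt lam"
proof -
  have "bdd_above {bnorm lam (z1 - z2) |z1 z2. z1 \<in> Z \<and> z2 \<in> Z}"
    using diameter_bounded_bound[OF assms(2)] assms(1)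
    by (intro bdd_aboveI[where M = "sqrt lam * diameter Z"]) (auto simp: bnorm_eq dist_norm)
  then have "bnorm lam (v - w) \<le> bdiam lam Z"
    unfolding bdiam_def using assms by (intro cSup_upper) auto
  then show ?thesis using assms(1) by (simp add: bnorm_eq field_simps)
qed

theorem corollary8:
  fixes f :: "(real^'n) \<times> (real^'m) \<Rightarrow> real"
    and X :: "(real^'n) set" and Y :: "(real^'m) set" and Z :: "((real^'n) \<times> (real^'m)) set"
    and M :: "'w measure"
    and uh u :: "nat \<Rightarrow> nat \<Rightarrow> 'w \<Rightarrow> (real^'n) \<times> (real^'m)"
    and z zh :: "nat \<Rightarrow> 'w \<Rightarrow> (real^'n) \<times> (real^'m)"
    and z0 zs :: "(real^'n) \<times> (real^'m)"
    and lam L1 mu \<sigma> \<rho> h \<epsilon> d Dz r0 a b c e :: real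
    and t N :: nat
  assumes lam: "lam > 0" and L1: "L1 > 0"
    and f_diff: "\<And>v. f differentiable (at v)"
    and f_C1: "continuous_on UNIV (grad f)"
    and f_lip: "\<And>v w. dnorm lam (grad f v - grad f w) \<le> L1 * bnorm lam (v - w)"
    and Z: "Z = X \<times> Y" "Z \<noteq> {}" "compact Z" "convex Z"
    and mu: "mu > 0" and sigma: "\<sigma> \<ge> 0"
    and var: "\<And>v. (\<integral>w. (dnorm lam (oracle_G lam mu f v w - saddle_op (smoothing lam mu f) v))\<^sup>2
                     \<partial>gauss lam) \<le> \<sigma>\<^sup>2"
    and rho: "0 < \<rho>" "\<rho> < 1 / (24 * L1)"
    and zs: "zs \<in> Z"
    and pwmvi: "\<And>v vb s. v \<in> Z \<Longrightarrow> vb \<in> Z \<Longrightarrow> s > 0 \<Longrightarrow>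
          prox_map lam Z v s (saddle_op f vb) \<bullet> (vb - zs)
            + \<rho> / 2 * (dnorm lam (prox_map lam Z v s (saddle_op f vb)))\<^sup>2 \<ge> 0"
    and z0: "z0 \<in> Z"
    and t1: "t \<ge> 1"
    and h: "sqrt (6 * \<rho> / (L1 * lam\<^sup>2)) < h" "h \<le> 1 / (2 * L1 * lam)"
    and M: "prob_space M"
    and samples: "gauss_samples M lam (\<lambda>_. t) N uh u"
    and alg: "\<And>\<omega>. \<omega> \<in> space M \<Longrightarrow>
          vr_zo_eg lam mu f Z (\<lambda>_. h) (\<lambda>_. h) (\<lambda>_. t) N z0
            (\<lambda>k i. uh k i \<omega>) (\<lambda>k i. u k i \<omega>) (\<lambda>k. z k \<omega>) (\<lambda>k. zh k \<omega>)"
    and d: "d = real CARD('n) + real CARD('m)"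
    and Dz: "Dz = bdiam lam Z"
    and r0: "r0 = norm (z0 - zs)"
    and a: "a = 4 * \<rho> * lam * L1\<^sup>2 * (d + 3) ^ 3 / (lam\<^sup>2 * L1 * h\<^sup>2 - 6 * \<rho>)"
    and b: "b = 4 * lam * L1 * Dz * (d + 3) powr (3 / 2) / (lam\<^sup>2 * L1 * h\<^sup>2 - 6 * \<rho>)"
    and c: "c = (36 * \<rho> + 4 / L1 + 4) * lam * \<sigma>\<^sup>2 / (lam\<^sup>2 * L1 * h\<^sup>2 - 6 * \<rho>)"
    and e: "e = 2 * Dz * lam * \<sigma> / (lam\<^sup>2 * L1 * h\<^sup>2 - 6 * \<rho>)"
    and eps: "\<epsilon> > 0"
    and t_ge: "int t \<ge> 32 * \<lceil>max (c / \<epsilon>\<^sup>2) (e\<^sup>2 / \<epsilon> ^ 4)\<rceil>"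
    and mu_le: "mu \<le> min ((- b + sqrt (b\<^sup>2 + a * \<epsilon>\<^sup>2)) / (2 * a))
                         (\<epsilon> / (sqrt 2 * lam * L1 * (d + 3) powr (3 / 2)))"
    and N_ge: "int N \<ge> \<lceil>(32 * lam\<^sup>2 * L1 * r0\<^sup>2 / (lam\<^sup>2 * L1 * h\<^sup>2 - 6 * \<rho>)) / \<epsilon>\<^sup>2 - 1\<rceil>"
  shows "1 / (real N + 1) *
           (\<Sum>k=0..N. prob_space.expectation M
                (\<lambda>\<omega>. (norm (prox_map lam Z (z k \<omega>) h (saddle_op f (z k \<omega>))))\<^sup>2)) \<le> \<epsilon>\<^sup>2"
proof -
  interpret prob_space M by (rule M)

  \<comment> \<open>Constants and parameters in the Euclidean norm\<close>
  define L where "L = lam * L1"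
  \<comment> \<open>\<open>lam * D\<close> is the common denominator of \<open>a\<close>,
    \<open>b\<close>, \<open>c\<close> and \<open>e\<close>. \<open>L\<close> is the Euclidean
    Lipschitz constant of the gradient, since each of the two norms contributes a factor
    \<open>sqrt lam\<close>.\<close>
  define D where "D = L * h\<^sup>2 - 6 * (\<rho> / lam)"
  define \<Delta> where "\<Delta> = Dz / sqrt lam"
  define P where "P = closest_point Z"
  define S where "S = sqrt (lam * \<sigma>\<^sup>2 / t)"
  define \<beta> where "\<beta> = lam * mu * L * (sqrt 3 * sqrt ((real CARD('n) + real CARD('m)) / lam) ^ 3)"
  let ?F = "saddle_op f"
  let ?p = "\<lambda>k \<omega>. prox_map lam Z (z k \<omega>) h (?F (z k \<omega>))"

  have L: "L > 0" using lam L1 by (simp add: L_def)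
  have sqrt_lam: "sqrt lam * (sqrt lam * x) = lam * x" for x
    using lam by (simp flip: mult.assoc)
  have lip: "norm (grad f v - grad f w) \<le> L * norm (v - w)" for v w
    using f_lip[of v w] lam by (simp add: L_def bnorm_eq dnorm_eq field_simps sqrt_lam)
  interpret smooth: smooth_oracle f lam mu L
    by unfold_locales (use lam mu L f_diff lip in auto)
  have closed: "closed Z" and bdd: "bounded Z"
    using Z(3) by (auto intro: compact_imp_closed compact_imp_bounded)
  have Proj_P: "Proj lam Z = P"
    using Proj_eq_closest_point[OF lam closed Z(4,2)] by (auto simp: P_def)
  have P_in: "P w \<in> Z" for w unfolding P_def by (rule closest_point_in_set[OF closed Z(2)])
  have P_meas [measurable]: "P \<in> borel_measurable borel"
    unfolding P_def by (intro borel_measurable_continuous_onI continuous_on_closest_point Z closed)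
  have diam: "norm (v - w) \<le> \<Delta>" if "v \<in> Z" "w \<in> Z" for v w
    using norm_diff_le_bdiam[OF lam bdd that] by (simp add: \<Delta>_def Dz)
  have \<Delta>_nonneg: "\<Delta> \<ge> 0" using order.trans[OF norm_ge_zero diam[OF zs zs]] .
  have \<beta>_nonneg: "\<beta> \<ge> 0" using lam mu L by (simp add: \<beta>_def)

  have h_pos: "h > 0" using h(1) rho lam L1 by (smt (verit) real_sqrt_ge_zero divide_nonneg_pos zero_less_power mult_pos_pos)
  have Lh: "L * h \<le> 1 / 2" using h(2) lam L1 by (simp add: L_def field_simps)
  have D_pos: "D > 0"
  proof -
    have "6 * \<rho> / (L1 * lam\<^sup>2) < h\<^sup>2"
      using h(1) h_pos by (metis real_sqrt_less_iff real_sqrt_abs abs_of_pos)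
    then show ?thesis using lam L1 by (simp add: D_def L_def field_simps power2_eq_square)
  qed
  have D_le: "D \<le> L * h\<^sup>2" using rho lam by (simp add: D_def)
  have D_eq: "lam\<^sup>2 * L1 * h\<^sup>2 - 6 * \<rho> = lam * D"
    using lam by (simp add: D_def L_def field_simps power2_eq_square)
  \<comment> \<open>Positivity of \<open>D\<close>, hence the lower bound on \<open>h\<close>,
    together with \<open>L * h\<close> at most 1/2 makes the Minty weight small against
    \<open>h\<close>. The dual norm accounts for the division by \<open>lam\<close>.\<close>
  have r_le: "\<rho> / lam \<le> h / 12"
  proof -
    have "6 * (\<rho> / lam) \<le> (L * h) * h" using D_pos by (simp add: D_def power2_eq_square mult.assoc)
    also have "\<dots> \<le> 1 / 2 * h" using Lh h_pos by (intro mult_right_mono) auto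
    finally show ?thesis by (simp add: mult.commute)
  qed

  \<comment> \<open>The samples as one independent family\<close>
  have Plus_iff: "Inl p \<in> U <+> V \<longleftrightarrow> p \<in> U" "Inr p \<in> U <+> V \<longleftrightarrow> p \<in> V"
    for p :: "nat \<times> nat" and U V by auto
  define I where "I = (SIGMA k:{..N}. {1..t}) <+> (SIGMA k:{..N}. {1..t})"
  define X where "X = case_sum (\<lambda>(k, i). uh k i) (\<lambda>(k, i). u k i)"
  have X_simps [simp]: "X (Inl (k, i)) = uh k i" "X (Inr (k, i)) = u k i" for k i
    by (simp_all add: X_def)
  have indep: "indep_vars (\<lambda>_. borel) X I"
    using samples by (simp add: gauss_samples_def X_def I_def)
  have X_meas: "X i \<in> borel_measurable M" if "i \<in> I" for i
    using indep that by (auto simp: indep_vars_def)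
  have law: "distr M borel (X i) = gauss lam" if "i \<in> I" for i
  proof -
    have "distributed M lborel (X i) (\<lambda>v. ennreal (gauss_density lam v))"
      using samples that by (auto simp: gauss_samples_def I_def)
    then have "distr M lborel (X i) = gauss lam" by (simp add: distributed_def gauss_def)
    then show ?thesis by (metis (mono_tags, lifting) distr_cong sets_lborel)
  qed
  have samples_meas [measurable]: "uh k i \<in> borel_measurable M" "u k i \<in> borel_measurable M"
    if "k \<le> N" "i \<in> {1..t}" for k i
    using X_meas[of "Inl (k, i)"] X_meas[of "Inr (k, i)"] that
    by (simp_all add: I_def Plus_iff)

  \<comment> \<open>Bias and variance of the oracle along the run\<close>
  let ?c = "\<lambda>v. saddle_op (smoothing lam mu f) v"
  have var': "(\<integral>w. (norm (oracle_G lam mu f v w - ?c v))\<^sup>2 \<partial>gauss lam) \<le> lam * \<sigma>\<^sup>2" for v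
    using var[of v] lam by (simp add: dnorm_eq power_divide field_simps)
  define m where "m = (\<lambda>v. \<integral>w. oracle_G lam mu f v w \<partial>gauss lam)"
  have bias: "norm (m v - ?F v) \<le> \<beta>" for v
    using smooth.oracle_bias by (simp add: m_def \<beta>_def)
  have m_meas [measurable]: "m \<in> borel_measurable borel"
    unfolding m_def by (rule smooth.borel_measurable_oracle_mean)
  have F_meas [measurable]: "?F \<in> borel_measurable borel"
  proof -
    have "continuous_on UNIV (\<lambda>v. conj_pair (grad f v))"
      by (rule continuous_on_compose2[OF linear_continuous_on[OF bounded_linear_conj_pair] f_C1 subset_UNIV])
    then have "continuous_on UNIV ?F" by (simp add: saddle_op_eq_grad[OF f_diff])
    then show ?thesis by (rule borel_measurable_continuous_onI)
  qed

  \<comment> \<open>Iterates as functions of past samples\<close>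
  define bh where "bh = (\<lambda>k \<omega>. batch_G lam mu f t (\<lambda>i. uh k i \<omega>) (z k \<omega>))"
  define bu where "bu = (\<lambda>k \<omega>. batch_G lam mu f t (\<lambda>i. u k i \<omega>) (zh k \<omega>))"
  have z_0: "z 0 \<omega> = z0" and z_half: "k \<le> N \<Longrightarrow> zh k \<omega> = P (z k \<omega> - h *\<^sub>R bh k \<omega>)"
    and z_Suc: "k \<le> N \<Longrightarrow> z (Suc k) \<omega> = P (z k \<omega> - h *\<^sub>R bu k \<omega>)" if "\<omega> \<in> space M" for k \<omega>
    using alg[OF that] by (simp_all add: vr_zo_eg_def Proj_P bh_def bu_def)
  have z_in: "z k \<omega> \<in> Z" if "\<omega> \<in> space M" "k \<le> Suc N" for k \<omega>
    using that z0 P_in by (cases k) (auto simp: z_0 z_Suc)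

  \<comment> \<open>\<open>past k\<close> indexes both batches of all iterations before
    \<open>k\<close>; \<open>half k\<close> adds the extrapolation batch of iteration
    \<open>k\<close>. The batch used next is thus always outside the index set.\<close>
  define past where "past = (\<lambda>k::nat. (SIGMA j:{..<k}. {1..t}) <+> (SIGMA j:{..<k}. {1..t}))"
  define half where "half = (\<lambda>k::nat. (SIGMA j:{..k}. {1..t}) <+> (SIGMA j:{..<k}. {1..t}))"
  have in_past: "Inl (j, i) \<in> past k" "Inr (j, i) \<in> past k" if "j < k" "i \<in> {1..t}" for j i k
    using that by (auto simp: past_def)
  have in_half: "Inl (j, i) \<in> half k" if "j \<le> k" "i \<in> {1..t}" for j i k
    using that by (auto simp: half_def)
  have in_half': "Inr (j, i) \<in> half k" if "j < k" "i \<in> {1..t}" for j i k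
    using that by (auto simp: half_def)
  let ?it = "eg_iter P (batch_G lam mu f t) h z0"
  let ?hf = "eg_half P (batch_G lam mu f t) h z0"
  have it_meas: "?it k \<in> borel_measurable (PiM (past k) (\<lambda>_. borel))" for k
    by (rule smooth.borel_measurable_eg_iter[OF P_meas]) (auto simp: past_def)
  have hf_meas: "?hf k \<in> borel_measurable (PiM (half k) (\<lambda>_. borel))" for k
    by (rule smooth.borel_measurable_eg_half[OF P_meas]) (auto simp: half_def)
  have z_it: "z k \<omega> = ?it k (\<lambda>i\<in>past k. X i \<omega>)" if "\<omega> \<in> space M" "k \<le> Suc N" for k \<omega>
    by (rule vr_zo_eg_eq_eg_iter[OF alg[OF that(1)] that(2), unfolded Proj_P])
      (simp add: in_past restrict_apply')
  have zh_hf: "zh k \<omega> = ?hf k (\<lambda>i\<in>half k. X i \<omega>)" if "\<omega> \<in> space M" "k \<le> N" for k \<omega>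
    by (rule vr_zo_eg_eq_eg_half[OF alg[OF that(1)] that(2), unfolded Proj_P])
      (simp_all add: in_half in_half' restrict_apply')
  have past_I: "past k \<subseteq> I" if "k \<le> Suc N" for k using that by (auto simp: past_def I_def)
  have half_I: "half k \<subseteq> I" if "k \<le> N" for k using that by (auto simp: half_def I_def)
  have z_meas [measurable]: "z k \<in> borel_measurable M" if "k \<le> Suc N" for k
  proof -
    have "(\<lambda>\<omega>. \<lambda>i\<in>past k. X i \<omega>) \<in> measurable M (PiM (past k) (\<lambda>_. borel))"
      using past_I[OF that] X_meas by (intro measurable_restrict) auto
    from measurable_compose[OF this it_meas] show ?thesis
      by (subst measurable_cong[OF z_it[OF _ that]]) auto
  qed
  have zh_meas [measurable]: "zh k \<in> borel_measurable M" if "k \<le> N" for k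
  proof -
    have "(\<lambda>\<omega>. \<lambda>i\<in>half k. X i \<omega>) \<in> measurable M (PiM (half k) (\<lambda>_. borel))"
      using half_I[OF that] X_meas by (intro measurable_restrict) auto
    from measurable_compose[OF this hf_meas] show ?thesis
      by (subst measurable_cong[OF zh_hf[OF _ that]]) auto
  qed
  have b_meas [measurable]: "bh k \<in> borel_measurable M" "bu k \<in> borel_measurable M" if "k \<le> N" for k
    unfolding bh_def bu_def using that
    by (auto intro!: smooth.borel_measurable_batch_G samples_meas z_meas zh_meas)

  \<comment> \<open>Noise of the two batches\<close>
  define A where "A = (\<lambda>k \<omega>. norm (bh k \<omega> - m (z k \<omega>)))"
  define B where "B = (\<lambda>k \<omega>. norm (bu k \<omega> - m (zh k \<omega>)))"
  have AB_meas [measurable]: "A k \<in> borel_measurable M" "B k \<in> borel_measurable M" if "k \<le> N" for k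
  proof -
    have [measurable]: "z k \<in> borel_measurable M" "zh k \<in> borel_measurable M"
      "bh k \<in> borel_measurable M" "bu k \<in> borel_measurable M"
      using that z_meas[of k] zh_meas b_meas by auto
    show "A k \<in> borel_measurable M" "B k \<in> borel_measurable M"
      unfolding A_def B_def by measurable
  qed
  have S2: "S\<^sup>2 = lam * \<sigma>\<^sup>2 / t" "S \<ge> 0" using lam by (simp_all add: S_def)
  have EA: "integrable M (\<lambda>\<omega>. (A k \<omega>)\<^sup>2)" "expectation (\<lambda>\<omega>. (A k \<omega>)\<^sup>2) \<le> S\<^sup>2" if k: "k \<le> N" for k
  proof -
    have "(\<integral>\<^sup>+\<omega>. ennreal ((A k \<omega>)\<^sup>2) \<partial>M)
        = (\<integral>\<^sup>+\<omega>. ennreal ((norm (batch_G lam mu f t (\<lambda>i. X (Inl (k, i)) \<omega>) (?it k (\<lambda>i\<in>past k. X i \<omega>))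
            - (\<integral>u. oracle_G lam mu f (?it k (\<lambda>i\<in>past k. X i \<omega>)) u \<partial>gauss lam)))\<^sup>2) \<partial>M)"
      using k by (intro nn_integral_cong) (simp add: A_def bh_def m_def z_it[symmetric])
    also have "\<dots> \<le> ennreal (lam * \<sigma>\<^sup>2 / t)"
      using k past_I by (intro smooth.adapted_batch_mean_sq_error[OF M indep law _ it_meas _ _ var' t1])
        (auto simp: inj_on_def I_def past_def)
    finally show "integrable M (\<lambda>\<omega>. (A k \<omega>)\<^sup>2)" "expectation (\<lambda>\<omega>. (A k \<omega>)\<^sup>2) \<le> S\<^sup>2"
      using integral_le_of_nn_integral_le[of "\<lambda>\<omega>. (A k \<omega>)\<^sup>2" M "S\<^sup>2"] AB_meas[OF k] by (simp_all flip: S2(1))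
  qed
  have EB: "integrable M (B k)" "expectation (B k) \<le> S" if k: "k \<le> N" for k
  proof -
    have "(\<integral>\<^sup>+\<omega>. ennreal ((B k \<omega>)\<^sup>2) \<partial>M)
        = (\<integral>\<^sup>+\<omega>. ennreal ((norm (batch_G lam mu f t (\<lambda>i. X (Inr (k, i)) \<omega>) (?hf k (\<lambda>i\<in>half k. X i \<omega>))
            - (\<integral>u. oracle_G lam mu f (?hf k (\<lambda>i\<in>half k. X i \<omega>)) u \<partial>gauss lam)))\<^sup>2) \<partial>M)"
      using k by (intro nn_integral_cong) (simp add: B_def bu_def m_def zh_hf[symmetric])
    also have "\<dots> \<le> ennreal (lam * \<sigma>\<^sup>2 / t)"
      using k half_I by (intro smooth.adapted_batch_mean_sq_error[OF M indep law _ hf_meas _ _ var' t1])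
        (auto simp: inj_on_def I_def half_def)
    finally have "integrable M (\<lambda>\<omega>. (B k \<omega>)\<^sup>2)" "expectation (\<lambda>\<omega>. (B k \<omega>)\<^sup>2) \<le> S\<^sup>2"
      using integral_le_of_nn_integral_le[of "\<lambda>\<omega>. (B k \<omega>)\<^sup>2" M "S\<^sup>2"] AB_meas[OF k] by (simp_all flip: S2(1))
    \<comment> \<open>The update noise enters the step bound linearly, so its mean suffices.\<close>
    from expectation_le_sqrt_expectation_sq[OF AB_meas(2)[OF k] this] S2(2)
    show "integrable M (B k)" "expectation (B k) \<le> S" by simp_all
  qed

  \<comment> \<open>Residuals and the one-step inequality\<close>
  have hp: "h\<^sup>2 * (norm (?p k \<omega>))\<^sup>2 = (norm (z k \<omega> - P (z k \<omega> - h *\<^sub>R ?F (z k \<omega>))))\<^sup>2" for k \<omega>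
    using h_pos by (simp add: prox_map_def Proj_P power_divide)
  \<comment> \<open>Both points lie in \<open>Z\<close>. The bound gives integrability and later
    settles the case of a large \<open>\<epsilon>\<close>.\<close>
  have p_le: "norm (?p k \<omega>) \<le> \<Delta> / h" if "k \<le> N" "\<omega> \<in> space M" for k \<omega>
    using h_pos diam[OF z_in P_in] that by (simp add: prox_map_def Proj_P divide_right_mono)
  have p_meas [measurable]: "?p k \<in> borel_measurable M" if "k \<le> N" for k
  proof -
    have [measurable]: "z k \<in> borel_measurable M" using that z_meas[of k] by simp
    show ?thesis unfolding prox_map_def Proj_P by measurable
  qed
  have p_int: "integrable M (\<lambda>\<omega>. (norm (?p k \<omega>))\<^sup>2)" if "k \<le> N" for k
    using that p_meas[OF that] p_le[OF that]
    by (intro integrable_const_bound[where B = "(\<Delta> / h)\<^sup>2"] AE_I2) (auto intro!: power_mono)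

  define v where "v = (\<lambda>k \<omega>. (norm (z k \<omega> - zs))\<^sup>2)"
  have v_int: "integrable M (v k)" if "k \<le> Suc N" for k
    using that z_meas[OF that] diam[OF z_in zs] unfolding v_def
    by (intro integrable_const_bound[where B = "\<Delta>\<^sup>2"] AE_I2) (auto intro!: power_mono)
  have step: "v (Suc k) \<omega> \<le> v k \<omega> - h\<^sup>2 / 3 * (norm (?p k \<omega>))\<^sup>2
      + 14 * h\<^sup>2 * ((A k \<omega>)\<^sup>2 + \<beta>\<^sup>2) + 2 * \<Delta> * h * (\<beta> + B k \<omega>)" if k: "k \<le> N" and \<omega>: "\<omega> \<in> space M" for k \<omega>
  proof -
    have zh_in: "zh k \<omega> \<in> Z" using z_half[OF \<omega> k] P_in by simp
    have "v (Suc k) \<omega> \<le> v k \<omega> - (norm (z k \<omega> - P (z k \<omega> - h *\<^sub>R ?F (z k \<omega>))))\<^sup>2 / 3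
        + 7 * (h * norm (?F (z k \<omega>) - bh k \<omega>))\<^sup>2 + 2 * \<Delta> * (h * norm (bu k \<omega> - ?F (zh k \<omega>)))"
      unfolding v_def z_Suc[OF \<omega> k] P_def
    proof (rule extragradient_step[OF Z(4) closed z_in[OF \<omega>] zs diam h_pos Lh r_le])
      show "zh k \<omega> = closest_point Z (z k \<omega> - h *\<^sub>R bh k \<omega>)" using z_half[OF \<omega> k] by (simp add: P_def)
      show "norm (?F (zh k \<omega>) - ?F (z k \<omega>)) \<le> L * norm (zh k \<omega> - z k \<omega>)"
        by (rule saddle_op_lipschitz[OF f_diff lip])
      show "0 \<le> (1 / h) *\<^sub>R (z k \<omega> - closest_point Z (z k \<omega> - h *\<^sub>R ?F (zh k \<omega>))) \<bullet> (zh k \<omega> - zs)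
          + \<rho> / lam / 2 * (norm ((1 / h) *\<^sub>R (z k \<omega> - closest_point Z (z k \<omega> - h *\<^sub>R ?F (zh k \<omega>)))))\<^sup>2"
        using pwmvi[OF z_in[OF \<omega>] zh_in h_pos, of k] k lam
        by (simp add: prox_map_def Proj_P P_def dnorm_eq power_divide power_mult_distrib mult.commute)
    qed (use k in auto)
    \<comment> \<open>Splitting the error into noise and bias doubles the squares, turning 7 into
      14.\<close>
    moreover have "(h * norm (?F (z k \<omega>) - bh k \<omega>))\<^sup>2 \<le> 2 * h\<^sup>2 * ((A k \<omega>)\<^sup>2 + \<beta>\<^sup>2)"
    proof -
      have "norm (?F (z k \<omega>) - bh k \<omega>) \<le> A k \<omega> + \<beta>"
        using norm_triangle_ineq[of "?F (z k \<omega>) - m (z k \<omega>)" "m (z k \<omega>) - bh k \<omega>"] bias[of "z k \<omega>"]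
        by (simp add: A_def norm_minus_commute)
      then have "(norm (?F (z k \<omega>) - bh k \<omega>))\<^sup>2 \<le> (A k \<omega> + \<beta>)\<^sup>2" by (intro power_mono) auto
      also have "\<dots> \<le> 2 * ((A k \<omega>)\<^sup>2 + \<beta>\<^sup>2)"
        using sum_squares_bound[of "A k \<omega>" \<beta>] by (simp add: power2_sum)
      finally show ?thesis
        using h_pos by (simp add: power_mult_distrib mult.left_commute mult_left_mono)
    qed
    moreover have "2 * \<Delta> * (h * norm (bu k \<omega> - ?F (zh k \<omega>))) \<le> 2 * \<Delta> * (h * (\<beta> + B k \<omega>))"
    proof -
      have "norm (bu k \<omega> - ?F (zh k \<omega>)) \<le> \<beta> + B k \<omega>"
        using norm_triangle_ineq[of "bu k \<omega> - m (zh k \<omega>)" "m (zh k \<omega>) - ?F (zh k \<omega>)"] bias[of "zh k \<omega>"]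
        by (simp add: B_def)
      then show ?thesis using h_pos \<Delta>_nonneg by (intro mult_left_mono) auto
    qed
    ultimately show ?thesis by (simp add: hp mult.assoc)
  qed

  \<comment> \<open>Telescoping in expectation\<close>
  define E where "E = (\<lambda>k. expectation (\<lambda>\<omega>. (norm (?p k \<omega>))\<^sup>2))"
  define C where "C = 14 * h\<^sup>2 * (S\<^sup>2 + \<beta>\<^sup>2) + 2 * \<Delta> * h * (\<beta> + S)"
  have E_step: "h\<^sup>2 / 3 * E k \<le> expectation (v k) - expectation (v (Suc k)) + C" if k: "k \<le> N" for k
  proof -
    note ints = v_int[of k] p_int[OF k] EA(1)[OF k] EB(1)[OF k]
    have "expectation (v (Suc k)) \<le> expectation (\<lambda>\<omega>. v k \<omega> - h\<^sup>2 / 3 * (norm (?p k \<omega>))\<^sup>2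
      + 14 * h\<^sup>2 * ((A k \<omega>)\<^sup>2 + \<beta>\<^sup>2) + 2 * \<Delta> * h * (\<beta> + B k \<omega>))"
      using k step[OF k] ints v_int[of "Suc k"] by (intro integral_mono) auto
    also have "\<dots> = expectation (v k) - h\<^sup>2 / 3 * E k
      + 14 * h\<^sup>2 * (expectation (\<lambda>\<omega>. (A k \<omega>)\<^sup>2) + \<beta>\<^sup>2) + 2 * \<Delta> * h * (\<beta> + expectation (B k))"
      using k ints by (simp add: E_def prob_space)
    also have "\<dots> \<le> expectation (v k) - h\<^sup>2 / 3 * E k
      + 14 * h\<^sup>2 * (S\<^sup>2 + \<beta>\<^sup>2) + 2 * \<Delta> * h * (\<beta> + S)"
      using EA(2)[OF k] EB(2)[OF k] h_pos \<Delta>_nonneg by (intro add_mono mult_left_mono) auto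
    finally show ?thesis by (simp add: C_def)
  qed
  have E_sum: "h\<^sup>2 / 3 * (\<Sum>k=0..N. E k) \<le> r0\<^sup>2 + (real N + 1) * C"
  proof -
    have "h\<^sup>2 / 3 * (\<Sum>k=0..N. E k) = (\<Sum>k<Suc N. h\<^sup>2 / 3 * E k)"
      by (simp add: sum_distrib_left atLeast0AtMost lessThan_Suc_atMost)
    also have "\<dots> \<le> (\<Sum>k<Suc N. (expectation (v k) - expectation (v (Suc k))) + C)"
      using E_step by (intro sum_mono) auto
    also have "\<dots> = expectation (v 0) - expectation (v (Suc N)) + (real N + 1) * C"
      unfolding sum.distrib using sum_lessThan_telescope'[of "\<lambda>k. expectation (v k)" "Suc N"]
      by (simp add: distrib_right del: sum.lessThan_Suc)
    also have "expectation (v 0) = r0\<^sup>2"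
      using z_0 by (simp add: v_def r0 prob_space cong: Bochner_Integration.integral_cong)
    finally have "h\<^sup>2 / 3 * (\<Sum>k=0..N. E k) \<le> r0\<^sup>2 - expectation (v (Suc N)) + (real N + 1) * C" .
    moreover have "expectation (v (Suc N)) \<ge> 0" by (simp add: v_def)
    ultimately show ?thesis by simp
  qed

  \<comment> \<open>Effect of the choices of \<open>t\<close>, \<open>mu\<close> and
    \<open>N\<close>\<close>
  have "(\<Sum>k=0..N. E k) \<le> (real N + 1) * \<epsilon>\<^sup>2"
  proof (cases "h * \<epsilon> \<le> \<Delta>")
    case False
    then have "\<Delta> / h \<le> \<epsilon>" using h_pos by (simp add: field_simps)
    then have "E k \<le> \<epsilon>\<^sup>2" if "k \<le> N" for k
    proof -
      have "E k \<le> expectation (\<lambda>_. \<epsilon>\<^sup>2)"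
        unfolding E_def using p_int[OF that] order.trans[OF p_le[OF that] \<open>\<Delta> / h \<le> \<epsilon>\<close>]
        by (intro integral_mono) (auto intro!: power_mono)
      then show ?thesis by (simp add: prob_space)
    qed
    then show ?thesis using sum_bounded_above[of "{0..N}" E "\<epsilon>\<^sup>2"] by (simp add: add.commute)
  next
    case True
    define K where "K = (d + 3) powr (3 / 2)"
    have t_pos: "real t > 0" using t1 by simp
    have max_t: "32 * max (c / \<epsilon>\<^sup>2) (e\<^sup>2 / \<epsilon> ^ 4) \<le> real t"
      using t_ge le_of_int_ceiling[of "max (c / \<epsilon>\<^sup>2) (e\<^sup>2 / \<epsilon> ^ 4)"] by linarith
    then have c_le: "32 * (c / \<epsilon>\<^sup>2) \<le> t" and e_le: "32 * (e\<^sup>2 / \<epsilon> ^ 4) \<le> t" by auto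
    \<comment> \<open>Only the summand \<open>4 / L1\<close> of \<open>c\<close> is kept; 128 is 32
      * 4.\<close>
    have "128 * S\<^sup>2 \<le> L * (D * \<epsilon>\<^sup>2)"
    proof -
      have "4 / L1 * (lam * \<sigma>\<^sup>2) / (lam * D) \<le> c"
      proof -
        have "4 / L1 * (lam * \<sigma>\<^sup>2) \<le> (36 * \<rho> + 4 / L1 + 4) * (lam * \<sigma>\<^sup>2)"
          using rho lam by (intro mult_right_mono) auto
        then show ?thesis
          unfolding c D_eq using lam D_pos by (intro divide_right_mono) (auto simp: mult.assoc)
      qed
      moreover have "32 * c \<le> t * \<epsilon>\<^sup>2" using c_le eps by (simp add: field_simps)
      ultimately have "32 * (4 / L1 * (lam * \<sigma>\<^sup>2) / (lam * D)) \<le> t * \<epsilon>\<^sup>2" by linarith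
      then show ?thesis
        using lam L1 D_pos t_pos by (simp add: S2 L_def field_simps)
    qed
    \<comment> \<open>This comes from the bound on \<open>t\<close> through \<open>e\<close>: 0.0885
      is just above the square root of 1/128, where 128 = 32 * 4.\<close>
    moreover have "\<Delta> * S \<le> 0.0885 * (D * \<epsilon>\<^sup>2)"
    proof (rule power2_le_imp_le)
      have e: "e = 2 * Dz * \<sigma> / D" unfolding e D_eq using lam by simp
      have "32 * e\<^sup>2 \<le> t * \<epsilon> ^ 4" using e_le eps by (simp add: field_simps)
      then have "128 * (Dz\<^sup>2 * \<sigma>\<^sup>2) \<le> t * (D\<^sup>2 * \<epsilon> ^ 4)"
        unfolding e using D_pos by (simp add: power_divide power_mult_distrib field_simps)
      then have "128 * (Dz\<^sup>2 * \<sigma>\<^sup>2 / t) \<le> D\<^sup>2 * \<epsilon> ^ 4" using t_pos by (simp add: field_simps)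
      moreover have "(\<Delta> * S)\<^sup>2 = Dz\<^sup>2 * \<sigma>\<^sup>2 / t"
        using lam by (simp add: power_mult_distrib S2 \<Delta>_def power_divide)
      moreover have "1 / 128 * (D\<^sup>2 * \<epsilon> ^ 4) \<le> 0.0885\<^sup>2 * (D\<^sup>2 * \<epsilon> ^ 4)"
        by (intro mult_right_mono) (simp_all add: power2_eq_square)
      moreover have "(0.0885 * (D * \<epsilon>\<^sup>2))\<^sup>2 = 0.0885\<^sup>2 * (D\<^sup>2 * \<epsilon> ^ 4)"
        by (simp only: power_mult_distrib flip: power_mult) simp
      ultimately show "(\<Delta> * S)\<^sup>2 \<le> (0.0885 * (D * \<epsilon>\<^sup>2))\<^sup>2" by simp
    qed (use D_pos in simp)
    \<comment> \<open>The bound on \<open>mu\<close> through \<open>b\<close> gives a factor 1/16,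
      and \<open>sqrt 3\<close> is at most 1.76 = 16 * 0.11. All powers of \<open>lam\<close>
      cancel.\<close>
    moreover have "\<Delta> * \<beta> \<le> 0.11 * (D * \<epsilon>\<^sup>2)"
    proof -
      have d_pos: "d > 0" unfolding d by (intro add_pos_pos) simp_all
      have Dz_nonneg: "Dz \<ge> 0" using \<Delta>_nonneg lam by (simp add: \<Delta>_def zero_le_divide_iff)
      have a_pos: "a > 0" unfolding a D_eq using rho lam L1 D_pos d_pos by simp
      have b_eq: "b = 4 * L1 * Dz * K / D" unfolding b D_eq K_def using lam by simp
      have "4 * b * mu \<le> \<epsilon>\<^sup>2"
        using mu_le mu a_pos Dz_nonneg L1 D_pos
        by (intro smoothing_parameter_bound[of a]) (auto simp: b_eq K_def)
      then have 1: "16 * (Dz * L1 * mu * K) \<le> D * \<epsilon>\<^sup>2"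
        unfolding b_eq using D_pos by (simp add: field_simps)
      have "sqrt d ^ 3 = d powr (3 / 2)"
        using d_pos by (simp add: powr_half_sqrt[symmetric] powr_power)
      also have "\<dots> \<le> K" unfolding K_def using d_pos by (intro powr_mono2) auto
      finally have K: "sqrt d ^ 3 \<le> K" .
      have "\<Delta> * \<beta> = sqrt 3 * (Dz * L1 * mu * sqrt d ^ 3)"
      proof -
        have "sqrt lam * sqrt lam ^ 3 = lam * lam"
          using lam by (simp add: power3_eq_cube)
        then show ?thesis using lam
          by (simp add: \<Delta>_def \<beta>_def L_def real_sqrt_divide power_divide flip: d)
      qed
      also have "\<dots> \<le> 1.76 * (Dz * L1 * mu * K)"
      proof (rule mult_mono)
        show "sqrt 3 \<le> 1.76" by (rule real_le_lsqrt) (simp_all add: power2_eq_square)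
        show "Dz * L1 * mu * sqrt d ^ 3 \<le> Dz * L1 * mu * K"
          using K Dz_nonneg L1 mu by (intro mult_left_mono) auto
      qed (use Dz_nonneg L1 mu d_pos in auto)
      also have "\<dots> = 0.11 * (16 * (Dz * L1 * mu * K))" by simp
      also have "\<dots> \<le> 0.11 * (D * \<epsilon>\<^sup>2)" using 1 by (rule mult_left_mono) simp
      finally show ?thesis .
    qed
    \<comment> \<open>The \<open>- 1\<close> inside the ceiling matches the \<open>N + 1\<close>
      iterations.\<close>
    moreover have "32 * L * r0\<^sup>2 \<le> (real N + 1) * (D * \<epsilon>\<^sup>2)"
    proof -
      have "32 * lam\<^sup>2 * L1 * r0\<^sup>2 / (lam * D) / \<epsilon>\<^sup>2 - 1 \<le> real N"
        using N_ge unfolding D_eq by linarith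
      moreover have "32 * lam\<^sup>2 * L1 * r0\<^sup>2 / (lam * D) = 32 * L * r0\<^sup>2 / D"
        using lam by (simp add: L_def power2_eq_square)
      ultimately have "32 * L * r0\<^sup>2 / D / \<epsilon>\<^sup>2 \<le> real N + 1" by simp
      then show ?thesis using D_pos eps by (simp add: field_simps)
    qed
    ultimately show ?thesis
      using extragradient_complexity_arith[OF L h_pos Lh D_pos D_le eps \<beta>_nonneg S2(2) \<Delta>_nonneg _
          E_sum[unfolded C_def] True] by simp
  qed
  then show ?thesis by (simp add: E_def field_simps)
qed

end
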